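(* Let $\mathsf{G}=(S,(S_\Box,S_\Diamond),E)$ be a finite-state game and $\Phi=(W,D,\varrho,\mu,\nu)$ a window-stability objective with $\varrho:S\to\mathbb{N}_0^k$. Then there is a strategy scheme $\Gamma$ for $\mathsf{G}$ with $W\cdot(\max_\varrho\cdot W)^{k\cdot(W/D)}$ memory elements, computable in $\mathcal{O}(|S|^2\cdot|E|\cdot W^2\cdot(\max_\varrho\cdot W)^{2k\cdot(W/D)})$ time, which is permissive for $\Phi$.
   Context: A game is $\mathsf{G}=(S,(S_\Box,S_\Diamond),E)$ with a non-empty set $S$ of states partitioned into $S_\Box$ (Player $\Box$) and $S_\Diamond$ (Player $\Diamond$), edges $E\subseteq S\times S$, every state having an outgoing edge; finite-state if $S$ is finite. A run is an infinite path; an objective is a Borel set of runs. A strategy of Player $\odot$ is $\tau:S^*S_\odot\to S$ with $(s,\tau(hs))\in E$; $\Sigma_\mathsf{G},\Pi_\mathsf{G}$ are the strategy sets of $\Box,\Diamond$; $\mathit{Outcome}(\sigma,\pi,s)$ is the induced run. $\sigma$ achieves $\Phi$ in $s$ if all $\mathit{Outcome}(\sigma,\pi,s)$, $\pi\in\Pi_\mathsf{G}$, satisfy $\Phi$; $\Sigma^\Phi_\mathsf{G}(s)$ is the set of such $\sigma$. A finite sequence $s_0\dots s_n$ is consistent with $\sigma$ if it is a path and $\sigma(s_0\dots s_i)=s_{i+1}$ whenever $i<n$, $s_i\in S_\Box$. $\sigma\equiv_s\sigma'$ if they agree on all finite sequences from $s$ consistent with $\sigma$. Reward function $\varrho:S\to\mathbb{N}_0^k$;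 $\max_\varrho=\max\{\varrho(s)[i]\mid 1\le i\le k,s\in S\}$. For $W,D\in\mathbb{N}$ with $D\mid W$ and a run $\lambda=s_0s_1\dots$, $\mathit{lmp}_{W,D,\varrho,\ell}(\lambda)=\frac1W\sum_{i=0}^{W-1}\varrho(s_{\ell D+i})$ (componentwise). A window-stability objective $(W,D,\varrho,\mu,\nu)$ with $\mu,\nu\in\mathbb{Q}^k$ is the set of runs $\lambda$ with $\mu\le\mathit{lmp}_{W,D,\varrho,\ell}(\lambda)\le\nu$ componentwise for all $\ell\in\mathbb{N}_0$. A strategy scheme for $\mathsf{G}$ is $\Gamma=(\mathit{Mem},\mathit{Up},\mathit{Const},\mathit{Init})$ (memory elements = elements of $\mathit{Mem}$) with $\mathit{Mem}$ finite non-empty, $\mathit{Up}:S\times\mathit{Mem}\to\mathit{Mem}$, $\mathit{Const}:S_\Box\times\mathit{Mem}\to2^S$ with $\mathit{Const}(s,m)\subseteq\{s'\mid(s,s')\in E\}$, $\mathit{Init}:S\rightharpoonup\mathit{Mem}$ partial, such that $\mathit{Const}(s,m)\ne\emptyset$ for all $(s,m)\in\mathit{Reach}(\mathit{Init})$ with $s\in S_\Box$; $\mathit{Reach}(\mathit{Init})$ is the least set containing all $(s,\mathit{Init}(s))$ and containing $(s',\mathit{Up}(s'',m''))$ whenever it contains $(s'',m'')$, $(s'',s')\in E$, and $s'\in\mathit{Const}(s'',m'')$ if $s''\in S_\Box$. The game $\mathsf{G}_\Gamma$ has states $S\times\mathit{Mem}$ split as $(S_\Box\times\mathit{Mem},S_\Diamond\times\mathit{Mem})$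 and edges: from $(s,m)$, $s\in S_\Diamond$, to $(s',\mathit{Up}(s,m))$ for $(s,s')\in E$; from $(s,m)$, $s\in S_\Box$, $\mathit{Const}(s,m)\ne\emptyset$, to $(s',\mathit{Up}(s,m))$ for $s'\in\mathit{Const}(s,m)$; otherwise from $(s,m)$ only to itself. $\sigma$ is admitted by $\Gamma$ in $s$ if $\mathit{Init}(s)$ is defined and for every finite path $s_0\dots s_n$ from $s$ consistent with $\sigma$, with $m_0=\mathit{Init}(s_0)$, $m_{i+1}=\mathit{Up}(s_i,m_i)$, $s_{i+1}\in\mathit{Const}(s_i,m_i)$ whenever $i<n$, $s_i\in S_\Box$. Then $\tau[\sigma,s]\in\Sigma_{\mathsf{G}_\Gamma}$ maps a history $(s_0,m_0)\dots(s_n,m_n)$ from $(s,\mathit{Init}(s))$ to $(\sigma(s_0\dots s_n),\mathit{Up}(s_n,m_n))$. For $\tau\in\Sigma_{\mathsf{G}_\Gamma}$, $\sigma[\tau,s]\in\Sigma_\mathsf{G}$ satisfies, for each finite path $(s_0,m_0)\dots(s_n,m_n)$ from $(s,\mathit{Init}(s))$ consistent with $\tau$: $\sigma[\tau,s](s_0\dots s_n)=s_{n+1}$ iff $\tau((s_0,m_0)\dots(s_n,m_n))=(s_{n+1},m_{n+1})$. $\Lambda_\mathsf{G}\approx_s\Lambda_{\mathsf{G}_\Gamma}$ means: every $\sigma\in\Lambda_\mathsf{G}$ is admitted by $\Gamma$ in $s$ and some $\tau\in\Lambda_{\mathsf{G}_\Gamma}$ has $\tau[\sigma,s]\equiv_{(s,\mathit{Init}(s))}\tau$;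 and for every $\tau\in\Lambda_{\mathsf{G}_\Gamma}$ some $\sigma\in\Lambda_\mathsf{G}$ has $\sigma[\tau,s]\equiv_s\sigma$. $\Gamma$ is permissive for $\Phi$ if $\Sigma^\Phi_\mathsf{G}(s)\approx_s\Sigma_{\mathsf{G}_\Gamma}(s)$ for all $s\in S$, where $\Sigma_{\mathsf{G}_\Gamma}(s)=\emptyset$ if $\mathit{Init}(s)$ is undefined and $=\Sigma_{\mathsf{G}_\Gamma}$ otherwise.
   Formalization: When max_ϱ·W = 0 the base of the memory bound is taken as 1 (as printed it gives no memory elements), and when max_ϱ·W ≤ 1 the base of the time bound is taken as 2 (as printed it is 0 or independent of k, too little to read all the rewards). *)

theory Defs
  imports Complex_Main
begin

section \<open>Games, strategies, and objectives\<close>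

record 's game =
  states :: "'s set"
  box :: "'s set"
  dia :: "'s set"
  edges :: "('s \<times> 's) set"

definition game :: "'s game \<Rightarrow> bool" where
  "game G \<longleftrightarrow> states G \<noteq> {} \<and> box G \<union> dia G = states G \<and> box G \<inter> dia G = {} \<and>
     edges G \<subseteq> states G \<times> states G \<and> (\<forall>s\<in>states G. \<exists>s'. (s, s') \<in> edges G)"

definition run :: "'s game \<Rightarrow> (nat \<Rightarrow> 's) \<Rightarrow> bool" where
  "run G w \<longleftrightarrow> (\<forall>i. (w i, w (Suc i)) \<in> edges G)"

definition finite_path :: "'s game \<Rightarrow> 's list \<Rightarrow> bool" where
  "finite_path G h \<longleftrightarrow> h \<noteq> [] \<and> set h \<subseteq> states G \<and>
     (\<forall>i. Suc i < length h \<longrightarrow> (h ! i, h ! Suc i) \<in> edges G)"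

text \<open>Strategies are total functions on lists; only their values on non-empty sequences of states
  that end in a state of the respective player (the set \<open>A\<close>) are constrained.\<close>

definition strategies :: "'s game \<Rightarrow> 's set \<Rightarrow> ('s list \<Rightarrow> 's) set" where
  "strategies G A = {f. \<forall>h s. set h \<subseteq> states G \<and> s \<in> A \<longrightarrow> (s, f (h @ [s])) \<in> edges G}"

definition box_strategies :: "'s game \<Rightarrow> ('s list \<Rightarrow> 's) set" where
  "box_strategies G = strategies G (box G)"

definition dia_strategies :: "'s game \<Rightarrow> ('s list \<Rightarrow> 's) set" where
  "dia_strategies G = strategies G (dia G)"

primrec outcome_prefix ::
  "'s game \<Rightarrow> ('s list \<Rightarrow> 's) \<Rightarrow> ('s list \<Rightarrow> 's) \<Rightarrow> 's \<Rightarrow> nat \<Rightarrow> 's list" where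
  "outcome_prefix G \<sigma> \<pi> s 0 = [s]"
| "outcome_prefix G \<sigma> \<pi> s (Suc n) =
     (let h = outcome_prefix G \<sigma> \<pi> s n in h @ [if last h \<in> box G then \<sigma> h else \<pi> h])"

definition outcome ::
  "'s game \<Rightarrow> ('s list \<Rightarrow> 's) \<Rightarrow> ('s list \<Rightarrow> 's) \<Rightarrow> 's \<Rightarrow> nat \<Rightarrow> 's" where
  "outcome G \<sigma> \<pi> s n = last (outcome_prefix G \<sigma> \<pi> s n)"

definition achieves :: "'s game \<Rightarrow> ('s list \<Rightarrow> 's) \<Rightarrow> (nat \<Rightarrow> 's) set \<Rightarrow> 's \<Rightarrow> bool" where
  "achieves G \<sigma> \<Phi> s \<longleftrightarrow> (\<forall>\<pi>\<in>dia_strategies G. outcome G \<sigma> \<pi> s \<in> \<Phi>)"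

definition achieving_strategies :: "'s game \<Rightarrow> (nat \<Rightarrow> 's) set \<Rightarrow> 's \<Rightarrow> ('s list \<Rightarrow> 's) set" where
  "achieving_strategies G \<Phi> s = {\<sigma> \<in> box_strategies G. achieves G \<sigma> \<Phi> s}"

definition consistent :: "'s game \<Rightarrow> ('s list \<Rightarrow> 's) \<Rightarrow> 's list \<Rightarrow> bool" where
  "consistent G \<sigma> h \<longleftrightarrow> finite_path G h \<and>
     (\<forall>i. Suc i < length h \<and> h ! i \<in> box G \<longrightarrow> \<sigma> (take (Suc i) h) = h ! Suc i)"

definition strategy_equiv ::
  "'s game \<Rightarrow> 's \<Rightarrow> ('s list \<Rightarrow> 's) \<Rightarrow> ('s list \<Rightarrow> 's) \<Rightarrow> bool" where
  "strategy_equiv G s \<sigma> \<sigma>' \<longleftrightarrow>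
     (\<forall>h. consistent G \<sigma> h \<and> hd h = s \<and> last h \<in> box G \<longrightarrow> \<sigma> h = \<sigma>' h)"

section \<open>Window-stability objectives\<close>

text \<open>A vector of dimension \<open>k\<close> is a function on \<open>nat\<close> of which only the components
  \<open>i < k\<close> matter.\<close>

definition max_reward :: "'s game \<Rightarrow> nat \<Rightarrow> ('s \<Rightarrow> nat \<Rightarrow> nat) \<Rightarrow> nat" where
  "max_reward G k \<rho> = Max {\<rho> s i | s i. s \<in> states G \<and> i < k}"

definition lmp :: "nat \<Rightarrow> nat \<Rightarrow> ('s \<Rightarrow> nat \<Rightarrow> nat) \<Rightarrow> nat \<Rightarrow> (nat \<Rightarrow> 's) \<Rightarrow> nat \<Rightarrow> rat" where
  "lmp W D \<rho> l w i = 1 / of_nat W * (\<Sum>j<W. of_nat (\<rho> (w (l * D + j)) i))"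

definition window_stability ::
  "'s game \<Rightarrow> nat \<Rightarrow> nat \<Rightarrow> nat \<Rightarrow> ('s \<Rightarrow> nat \<Rightarrow> nat) \<Rightarrow> (nat \<Rightarrow> rat) \<Rightarrow> (nat \<Rightarrow> rat) \<Rightarrow> (nat \<Rightarrow> 's) set"
  where
  "window_stability G k W D \<rho> \<mu> \<nu> =
     {w. run G w \<and> (\<forall>l. \<forall>i<k. \<mu> i \<le> lmp W D \<rho> l w i \<and> lmp W D \<rho> l w i \<le> \<nu> i)}"

section \<open>Strategy schemes\<close>

record ('s, 'm) scheme =
  Mem :: "'m set"
  Up :: "'s \<Rightarrow> 'm \<Rightarrow> 'm"
  Const :: "'s \<Rightarrow> 'm \<Rightarrow> 's set"
  Init :: "'s \<Rightarrow> 'm option"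

inductive_set Reach :: "'s game \<Rightarrow> ('s, 'm) scheme \<Rightarrow> ('s \<times> 'm) set"
  for G :: "'s game" and \<Gamma> :: "('s, 'm) scheme" where
  init: "s \<in> states G \<Longrightarrow> Init \<Gamma> s = Some m \<Longrightarrow> (s, m) \<in> Reach G \<Gamma>"
| step: "(s, m) \<in> Reach G \<Gamma> \<Longrightarrow> (s, s') \<in> edges G \<Longrightarrow> (s \<in> box G \<Longrightarrow> s' \<in> Const \<Gamma> s m) \<Longrightarrow>
    (s', Up \<Gamma> s m) \<in> Reach G \<Gamma>"

definition strategy_scheme :: "'s game \<Rightarrow> ('s, 'm) scheme \<Rightarrow> bool" where
  "strategy_scheme G \<Gamma> \<longleftrightarrow>
     finite (Mem \<Gamma>) \<and> Mem \<Gamma> \<noteq> {} \<and>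
     (\<forall>s\<in>states G. \<forall>m\<in>Mem \<Gamma>. Up \<Gamma> s m \<in> Mem \<Gamma>) \<and>
     (\<forall>s\<in>box G. \<forall>m\<in>Mem \<Gamma>. Const \<Gamma> s m \<subseteq> {s'. (s, s') \<in> edges G}) \<and>
     (\<forall>s\<in>states G. \<forall>m. Init \<Gamma> s = Some m \<longrightarrow> m \<in> Mem \<Gamma>) \<and>
     (\<forall>s m. (s, m) \<in> Reach G \<Gamma> \<and> s \<in> box G \<longrightarrow> Const \<Gamma> s m \<noteq> {})"

definition scheme_game :: "'s game \<Rightarrow> ('s, 'm) scheme \<Rightarrow> ('s \<times> 'm) game" where
  "scheme_game G \<Gamma> =
     \<lparr>states = states G \<times> Mem \<Gamma>,
      box = box G \<times> Mem \<Gamma>,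
      dia = dia G \<times> Mem \<Gamma>,
      edges =
        {((s, m), (s', Up \<Gamma> s m)) | s m s'. s \<in> dia G \<and> m \<in> Mem \<Gamma> \<and> (s, s') \<in> edges G} \<union>
        {((s, m), (s', Up \<Gamma> s m)) | s m s'. s \<in> box G \<and> m \<in> Mem \<Gamma> \<and> s' \<in> Const \<Gamma> s m} \<union>
        {((s, m), (s, m)) | s m. s \<in> box G \<and> m \<in> Mem \<Gamma> \<and> Const \<Gamma> s m = {}}\<rparr>"

text \<open>The memory element in position \<open>i\<close> of a path \<open>h\<close> is \<open>fold (Up \<Gamma>) (take i h)\<close> applied to
  the initial one.\<close>

definition admitted :: "'s game \<Rightarrow> ('s, 'm) scheme \<Rightarrow> 's \<Rightarrow> ('s list \<Rightarrow> 's) \<Rightarrow> bool" where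
  "admitted G \<Gamma> s \<sigma> \<longleftrightarrow>
     (\<exists>m0. Init \<Gamma> s = Some m0 \<and>
       (\<forall>h. consistent G \<sigma> h \<and> hd h = s \<longrightarrow>
         (\<forall>i. Suc i < length h \<and> h ! i \<in> box G \<longrightarrow>
           h ! Suc i \<in> Const \<Gamma> (h ! i) (fold (Up \<Gamma>) (take i h) m0))))"

text \<open>\<open>lift_strategy \<Gamma> \<sigma>\<close> renders \<open>\<tau>[\<sigma>,s]\<close>. It is used only on histories that start in
  \<open>(s, Init s)\<close> and are consistent with it, for a \<open>\<sigma>\<close> admitted in \<open>s\<close>, where its moves are edges
  of the scheme game; its values elsewhere are irrelevant.\<close>

definition lift_strategy ::
  "('s, 'm) scheme \<Rightarrow> ('s list \<Rightarrow> 's) \<Rightarrow> ('s \<times> 'm) list \<Rightarrow> 's \<times> 'm" where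
  "lift_strategy \<Gamma> \<sigma> h = (\<sigma> (map fst h), Up \<Gamma> (fst (last h)) (snd (last h)))"

text \<open>\<open>projects_to G \<Gamma> \<tau> s \<sigma>\<close> says that \<open>\<sigma>\<close> is (a version of) \<open>\<sigma>[\<tau>,s]\<close>, which is determined
  only up to its values on sequences that do not come from histories consistent with \<open>\<tau>\<close>.\<close>

definition projects_to ::
  "'s game \<Rightarrow> ('s, 'm) scheme \<Rightarrow> (('s \<times> 'm) list \<Rightarrow> 's \<times> 'm) \<Rightarrow> 's \<Rightarrow> ('s list \<Rightarrow> 's) \<Rightarrow> bool" where
  "projects_to G \<Gamma> \<tau> s \<sigma> \<longleftrightarrow> \<sigma> \<in> box_strategies G \<and>
     (\<forall>h. consistent (scheme_game G \<Gamma>) \<tau> h \<and> hd h = (s, the (Init \<Gamma> s)) \<and>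
          last h \<in> box (scheme_game G \<Gamma>) \<longrightarrow>
       (\<forall>s'. \<sigma> (map fst h) = s' \<longleftrightarrow> (\<exists>m'. \<tau> h = (s', m'))))"

definition strategies_match ::
  "'s game \<Rightarrow> ('s, 'm) scheme \<Rightarrow> 's \<Rightarrow> ('s list \<Rightarrow> 's) set \<Rightarrow> (('s \<times> 'm) list \<Rightarrow> 's \<times> 'm) set \<Rightarrow> bool"
  where
  "strategies_match G \<Gamma> s A B \<longleftrightarrow>
     (\<forall>\<sigma>\<in>A. admitted G \<Gamma> s \<sigma> \<and>
       (\<exists>\<tau>\<in>B. strategy_equiv (scheme_game G \<Gamma>) (s, the (Init \<Gamma> s)) (lift_strategy \<Gamma> \<sigma>) \<tau>)) \<and>
     (\<forall>\<tau>\<in>B. \<exists>\<sigma>\<in>A. \<exists>\<sigma>'. projects_to G \<Gamma> \<tau> s \<sigma>' \<and> strategy_equiv G s \<sigma>' \<sigma>)"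

definition permissive :: "'s game \<Rightarrow> ('s, 'm) scheme \<Rightarrow> (nat \<Rightarrow> 's) set \<Rightarrow> bool" where
  "permissive G \<Gamma> \<Phi> \<longleftrightarrow>
     (\<forall>s\<in>states G. strategies_match G \<Gamma> s (achieving_strategies G \<Phi> s)
       (if Init \<Gamma> s = None then {} else box_strategies (scheme_game G \<Gamma>)))"

section \<open>Running time\<close>

text \<open>Running time is measured in a structured random access machine with the uniform cost
  criterion: programs operate on integer variables and (unbounded) integer arrays, and every
  evaluated operator, constant, variable access, array access, assignment and test costs one unit.
  A program mentions finitely many arrays, so up to a constant factor this is the usual RAM with
  one memory. A non-zero test value means true.\<close>

type_synonym name = string

datatype binop = Add | Sub | Mul | Div | Mod | Less | Eq

datatype expr = Num int | Var name | Arr name expr | Bin binop expr expr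

datatype prog =
    Skip
  | Assign name expr
  | Store name expr expr
  | Seq prog prog
  | If expr prog prog
  | While expr prog

record store =
  vars :: "name \<Rightarrow> int"
  arrs :: "name \<Rightarrow> int \<Rightarrow> int"

fun apply_binop :: "binop \<Rightarrow> int \<Rightarrow> int \<Rightarrow> int" where
  "apply_binop Add a b = a + b"
| "apply_binop Sub a b = a - b"
| "apply_binop Mul a b = a * b"
| "apply_binop Div a b = a div b"
| "apply_binop Mod a b = a mod b"
| "apply_binop Less a b = of_bool (a < b)"
| "apply_binop Eq a b = of_bool (a = b)"

primrec eval_expr :: "expr \<Rightarrow> store \<Rightarrow> int" where
  "eval_expr (Num c) s = c"
| "eval_expr (Var x) s = vars s x"
| "eval_expr (Arr a e) s = arrs s a (eval_expr e s)"
| "eval_expr (Bin f e1 e2) s = apply_binop f (eval_expr e1 s) (eval_expr e2 s)"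

primrec expr_cost :: "expr \<Rightarrow> nat" where
  "expr_cost (Num c) = 1"
| "expr_cost (Var x) = 1"
| "expr_cost (Arr a e) = 1 + expr_cost e"
| "expr_cost (Bin f e1 e2) = 1 + expr_cost e1 + expr_cost e2"

text \<open>\<open>exec P s t s'\<close>: started in \<open>s\<close>, the program \<open>P\<close> terminates in \<open>s'\<close> after exactly \<open>t\<close>
  units of time.\<close>

inductive exec :: "prog \<Rightarrow> store \<Rightarrow> nat \<Rightarrow> store \<Rightarrow> bool" where
  Skip: "exec Skip s 1 s"
| Assign: "exec (Assign x e) s (1 + expr_cost e) (s\<lparr>vars := (vars s)(x := eval_expr e s)\<rparr>)"
| Store: "exec (Store a i e) s (1 + expr_cost i + expr_cost e)
    (s\<lparr>arrs := (arrs s)(a := (arrs s a)(eval_expr i s := eval_expr e s))\<rparr>)"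
| Seq: "exec P s t s' \<Longrightarrow> exec Q s' u s'' \<Longrightarrow> exec (Seq P Q) s (t + u) s''"
| IfTrue: "eval_expr b s \<noteq> 0 \<Longrightarrow> exec P s t s' \<Longrightarrow> exec (If b P Q) s (1 + expr_cost b + t) s'"
| IfFalse: "eval_expr b s = 0 \<Longrightarrow> exec Q s t s' \<Longrightarrow> exec (If b P Q) s (1 + expr_cost b + t) s'"
| WhileFalse: "eval_expr b s = 0 \<Longrightarrow> exec (While b P) s (1 + expr_cost b) s"
| WhileTrue: "eval_expr b s \<noteq> 0 \<Longrightarrow> exec P s t s' \<Longrightarrow> exec (While b P) s' u s'' \<Longrightarrow>
    exec (While b P) s (1 + expr_cost b + t + u) s''"

text \<open>A finite game is presented to a program by an arbitrary enumeration \<open>ss\<close> of its states and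
  an arbitrary enumeration \<open>es\<close> of its edges as pairs of positions in \<open>ss\<close>.\<close>

definition presents :: "'s game \<Rightarrow> 's list \<Rightarrow> (nat \<times> nat) list \<Rightarrow> bool" where
  "presents G ss es \<longleftrightarrow>
     distinct ss \<and> set ss = states G \<and> distinct es \<and>
     set es = {(i, j). i < length ss \<and> j < length ss \<and> (ss ! i, ss ! j) \<in> edges G}"

definition array_of :: "int list \<Rightarrow> int \<Rightarrow> int" where
  "array_of xs i = (if 0 \<le> i \<and> i < int (length xs) then xs ! nat i else 0)"

definition input_store ::
  "'s game \<Rightarrow> 's list \<Rightarrow> (nat \<times> nat) list \<Rightarrow> nat \<Rightarrow> nat \<Rightarrow> nat \<Rightarrow>
   ('s \<Rightarrow> nat \<Rightarrow> nat) \<Rightarrow> (nat \<Rightarrow> rat) \<Rightarrow> (nat \<Rightarrow> rat) \<Rightarrow> store" where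
  "input_store G ss es k W D \<rho> \<mu> \<nu> =
     \<lparr>vars = (\<lambda>_. 0)
        (''states'' := int (length ss), ''edges'' := int (length es),
         ''k'' := int k, ''W'' := int W, ''D'' := int D),
      arrs = (\<lambda>_ _. 0)
        (''box'' := array_of (map (\<lambda>s. of_bool (s \<in> box G)) ss),
         ''src'' := array_of (map (\<lambda>e. int (fst e)) es),
         ''dst'' := array_of (map (\<lambda>e. int (snd e)) es),
         ''reward'' := array_of (map (\<lambda>a. int (\<rho> (ss ! (a div k)) (a mod k))) [0..<length ss * k]),
         ''mu_num'' := array_of (map (\<lambda>i. fst (quotient_of (\<mu> i))) [0..<k]),
         ''mu_den'' := array_of (map (\<lambda>i. snd (quotient_of (\<mu> i))) [0..<k]),
         ''nu_num'' := array_of (map (\<lambda>i. fst (quotient_of (\<nu> i))) [0..<k]),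
         ''nu_den'' := array_of (map (\<lambda>i. snd (quotient_of (\<nu> i))) [0..<k]))\<rparr>"

text \<open>The output is the full table of a scheme with memory \<open>{..<N}\<close>. As \<open>Const s m\<close> consists of
  successors of \<open>s\<close>, it is given by one bit per edge leaving \<open>s\<close>; the value \<open>-1\<close> marks an
  undefined \<open>Init s\<close>.\<close>

definition output_scheme ::
  "'s game \<Rightarrow> 's list \<Rightarrow> (nat \<times> nat) list \<Rightarrow> ('s, nat) scheme \<Rightarrow> store \<Rightarrow> bool" where
  "output_scheme G ss es \<Gamma> s \<longleftrightarrow>
     (\<exists>N. Mem \<Gamma> = {..<N} \<and> vars s ''N'' = int N \<and>
       (\<forall>i<length ss. \<forall>m<N. arrs s ''up'' (int (i * N + m)) = int (Up \<Gamma> (ss ! i) m)) \<and>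
       (\<forall>j<length es. \<forall>m<N. ss ! fst (es ! j) \<in> box G \<longrightarrow>
          arrs s ''const'' (int (j * N + m)) =
            of_bool (ss ! snd (es ! j) \<in> Const \<Gamma> (ss ! fst (es ! j)) m)) \<and>
       (\<forall>i<length ss. arrs s ''init'' (int i) =
          (case Init \<Gamma> (ss ! i) of None \<Rightarrow> -1 | Some m \<Rightarrow> int m)))"

end

theory Submission
  imports Defs
begin

text \<open>
  A window-stability objective is a safety condition on a finite monitor. The monitor counts time
  modulo \<open>W\<close> and keeps, for each of the \<open>W/D\<close> windows that are open at any time and each of the
  \<open>k\<close> dimensions, the reward accumulated so far, which is below \<open>max 1 (max\<^sub>\<rho> W)\<close> until the window
  closes. Before time \<open>W\<close> some of the windows that close never opened and must not be checked. The
  youngest open window has accumulated less than \<open>max 1 (max\<^sub>\<rho> D)\<close>, so there is room in its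
  counter to mark this phase by an offset, and no extra memory is needed.

  In the product of game and monitor, the greatest set in which Player \<open>\<box>\<close> can stay among the safe
  pairs is reached after at most \<open>|S| |Mem|\<close> refinement rounds. Allowing exactly the moves that
  stay in it yields a permissive scheme: the pairs visited by an achieving strategy form a
  self-supporting set of safe pairs, and conversely every run within the set satisfies the
  objective. Each round scans all pairs and all their edges once.
\<close>

text \<open>The prescribed number of memory elements is the obstacle: clock and counters exhaust it,
  so the start-up bit must hide in a counter. With \<open>M\<close> the largest reward, suppose
  \<open>M > 0\<close> and \<open>D < W\<close>. Divisibility gives \<open>2 * D \<le> W\<close>, so
  a counter below \<open>M * D\<close> stays below \<open>M * W\<close> after adding
  \<open>M * D\<close>. In the remaining cases no offset fits, yet none is missed: for
  \<open>D = W\<close> the single slot closes for the first time at time \<open>W - 1\<close>, when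
  a genuine window ends, and for \<open>M = 0\<close> every check compares the same value 0, as
  window 0 does anyway. A complete window can sum to \<open>M * W\<close>, which is not a digit. It
  is therefore judged while its last state is being read, before its counter is reset; this is why
  safety concerns pairs of a state and a memory element. In the time bound the base is at least 2 so
  that the exponential factor also pays for the linear factors \<open>k\<close> and
  \<open>k * (W div D)\<close> of reading rewards and tabulating the monitor.\<close>

text \<open>A round that changes the set loses at least one element. After \<open>card A\<close>
  rounds the iteration has therefore stalled or reached the empty set, which a deflating map
  fixes.\<close>

lemma funpow_deflating_fixpoint:
  fixes f :: "'a set \<Rightarrow> 'a set"
  assumes defl: "\<And>X. f X \<subseteq> X" and fin: "finite A" and "card A \<le> n"
  shows "f ((f ^^ n) A) = (f ^^ n) A"
proof -
  have sub: "(f ^^ i) A \<subseteq> A" for i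
    by (induction i) (use defl in auto)
  have "f ((f ^^ i) A) = (f ^^ i) A \<or> card ((f ^^ i) A) + i \<le> card A" for i
  proof (induction i)
    case (Suc i)
    show ?case
    proof (cases "f ((f ^^ i) A) = (f ^^ i) A")
      case False
      then have "card ((f ^^ i) A) + i \<le> card A" "f ((f ^^ i) A) \<subset> (f ^^ i) A"
        using Suc defl by auto
      moreover have "finite ((f ^^ i) A)"
        using sub fin finite_subset by blast
      ultimately show ?thesis
        using psubset_card_mono[of "(f ^^ i) A" "f ((f ^^ i) A)"] by simp
    qed simp
  qed simp
  from this[of n] show ?thesis
  proof
    assume "card ((f ^^ n) A) + n \<le> card A"
    with \<open>card A \<le> n\<close> have "card ((f ^^ n) A) = 0" by simp
    moreover have "finite ((f ^^ n) A)"
      using sub fin finite_subset by blast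
    ultimately show ?thesis using defl[of "{}"] by auto
  qed
qed

section \<open>Histories and outcomes\<close>

definition some_succ :: "'s game \<Rightarrow> 's \<Rightarrow> 's" where
  "some_succ G s = (SOME s'. (s, s') \<in> edges G)"

lemma some_succ:
  assumes "game G" "s \<in> states G"
  shows "(s, some_succ G s) \<in> edges G"
  using assms unfolding some_succ_def game_def by (metis someI_ex)

lemma consistent_single: "consistent G \<sigma> [s] \<longleftrightarrow> s \<in> states G"
  by (auto simp: consistent_def finite_path_def)

text \<open>Histories grow at the end, where a strategy makes its next move. The indexed definition
  becomes a condition on the last step, on which the inductions over consistent histories
  rest.\<close>

lemma consistent_snoc:
  assumes "game G" "h \<noteq> []"
  shows "consistent G \<sigma> (h @ [s]) \<longleftrightarrow>
    consistent G \<sigma> h \<and> (last h, s) \<in> edges G \<and> (last h \<in> box G \<longrightarrow> \<sigma> h = s)"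
proof -
  obtain n where n: "length h = Suc n" using assms(2) by (cases h) auto
  have s: "(a, s) \<in> edges G \<Longrightarrow> s \<in> states G" for a
    using assms(1) by (auto simp: game_def)
  have all: "(\<forall>i. Suc i < length (h @ [s]) \<longrightarrow> P i) \<longleftrightarrow> (\<forall>i. Suc i < length h \<longrightarrow> P i) \<and> P n" for P
    using n by (auto simp: less_Suc_eq)
  have "(\<forall>i. Suc i < length (h @ [s]) \<and> (h @ [s]) ! i \<in> box G \<longrightarrow>
          \<sigma> (take (Suc i) (h @ [s])) = (h @ [s]) ! Suc i) \<longleftrightarrow>
        (\<forall>i. Suc i < length h \<and> h ! i \<in> box G \<longrightarrow> \<sigma> (take (Suc i) h) = h ! Suc i) \<and>
        (last h \<in> box G \<longrightarrow> \<sigma> h = s)"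
    using all[of "\<lambda>i. (h @ [s]) ! i \<in> box G \<longrightarrow> \<sigma> (take (Suc i) (h @ [s])) = (h @ [s]) ! Suc i"] n
    by (auto simp: nth_append last_conv_nth assms(2))
  moreover have "(\<forall>i. Suc i < length (h @ [s]) \<longrightarrow> ((h @ [s]) ! i, (h @ [s]) ! Suc i) \<in> edges G) \<longleftrightarrow>
        (\<forall>i. Suc i < length h \<longrightarrow> (h ! i, h ! Suc i) \<in> edges G) \<and> (last h, s) \<in> edges G"
    using all[of "\<lambda>i. ((h @ [s]) ! i, (h @ [s]) ! Suc i) \<in> edges G"] n
    by (auto simp: nth_append last_conv_nth assms(2))
  ultimately show ?thesis
    using s assms(2) by (auto simp: consistent_def finite_path_def)
qed

lemma consistent_induct [consumes 2, case_names single snoc]: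
  assumes "game G" "consistent G \<sigma> h"
    and single: "\<And>s. s \<in> states G \<Longrightarrow> P [s]"
    and snoc: "\<And>h s. h \<noteq> [] \<Longrightarrow> consistent G \<sigma> h \<Longrightarrow> P h \<Longrightarrow> (last h, s) \<in> edges G \<Longrightarrow>
      (last h \<in> box G \<Longrightarrow> \<sigma> h = s) \<Longrightarrow> P (h @ [s])"
  shows "P h"
  using assms(2)
proof (induction h rule: rev_induct)
  case Nil
  then show ?case by (simp add: consistent_def finite_path_def)
next
  case (snoc x xs)
  then show ?case
    using single[of x] assms(4)[of xs x] consistent_snoc[OF assms(1), of xs \<sigma> x]
      consistent_single[of G \<sigma> x]
    by (cases "xs = []") auto
qed

lemma consistent_take:
  assumes "consistent G \<sigma> h" "0 < n"
  shows "consistent G \<sigma> (take n h)"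
  using assms by (auto simp: consistent_def finite_path_def min_def dest: in_set_takeD)

lemma consistent_nonempty: "consistent G \<sigma> h \<Longrightarrow> h \<noteq> []"
  by (simp add: consistent_def finite_path_def)

lemma consistent_states: "consistent G \<sigma> h \<Longrightarrow> set h \<subseteq> states G"
  by (simp add: consistent_def finite_path_def)

lemma consistent_last: "consistent G \<sigma> h \<Longrightarrow> last h \<in> states G"
  using consistent_states consistent_nonempty last_in_set by blast

lemma strategies_move:
  assumes "f \<in> strategies G A" "h \<noteq> []" "set h \<subseteq> states G" "last h \<in> A"
  shows "(last h, f h) \<in> edges G"
proof -
  have "set (butlast h) \<subseteq> states G" using assms(3) by (meson in_set_butlastD subset_iff)
  then show ?thesis
    using assms unfolding strategies_def by (metis (mono_tags, lifting) append_butlast_last_id mem_Collect_eq)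
qed

lemma strategiesI:
  assumes "\<And>h. h \<noteq> [] \<Longrightarrow> last h \<in> A \<Longrightarrow> (last h, f h) \<in> edges G"
  shows "f \<in> strategies G A"
  using assms[of "_ @ [_]"] by (auto simp: strategies_def)

lemma outcome_prefix_nonempty: "outcome_prefix G \<sigma> \<pi> s n \<noteq> []"
  by (cases n) (auto simp: Let_def)

lemma hd_outcome_prefix: "hd (outcome_prefix G \<sigma> \<pi> s n) = s"
  by (induction n) (simp_all add: Let_def hd_append outcome_prefix_nonempty)

lemma outcome_prefix_eq_map: "outcome_prefix G \<sigma> \<pi> s n = map (outcome G \<sigma> \<pi> s) [0..<Suc n]"
proof (induction n)
  case (Suc n)
  have "outcome_prefix G \<sigma> \<pi> s (Suc n) =
      outcome_prefix G \<sigma> \<pi> s n @ [outcome G \<sigma> \<pi> s (Suc n)]"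
    by (simp add: outcome_def Let_def)
  then show ?case using Suc by simp
qed (simp add: outcome_def)

lemma outcome_prefix_consistent:
  assumes G: "game G" and "s \<in> states G" "\<sigma> \<in> box_strategies G" "\<pi> \<in> dia_strategies G"
  shows "consistent G \<sigma> (outcome_prefix G \<sigma> \<pi> s n)"
proof (induction n)
  case 0
  then show ?case using assms by (simp add: consistent_single)
next
  case (Suc n)
  let ?h = "outcome_prefix G \<sigma> \<pi> s n"
  have "last ?h \<in> box G \<or> last ?h \<in> dia G"
    using consistent_last[OF Suc] G by (auto simp: game_def)
  then have "(last ?h, if last ?h \<in> box G then \<sigma> ?h else \<pi> ?h) \<in> edges G"
    using assms strategies_move[OF _ outcome_prefix_nonempty consistent_states[OF Suc]]
    by (auto simp: box_strategies_def dia_strategies_def)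
  then show ?case
    using Suc by (auto simp: Let_def consistent_snoc[OF G outcome_prefix_nonempty])
qed

lemma outcome_run:
  assumes G: "game G" and "s \<in> states G" "\<sigma> \<in> box_strategies G" "\<pi> \<in> dia_strategies G"
  shows "run G (outcome G \<sigma> \<pi> s)"
  unfolding run_def
proof
  fix n
  have "consistent G \<sigma> (outcome_prefix G \<sigma> \<pi> s (Suc n))"
    by (rule outcome_prefix_consistent[OF assms])
  then show "(outcome G \<sigma> \<pi> s n, outcome G \<sigma> \<pi> s (Suc n)) \<in> edges G"
    by (simp add: Let_def consistent_snoc[OF G outcome_prefix_nonempty] outcome_def)
qed

text \<open>Achieving an objective speaks of infinite outcomes, whereas pairs are reached by finite
  histories. The opponent can steer the play along any history that \<open>\<sigma>\<close> allows,
  so an achieving \<open>\<sigma>\<close> must answer for each of them.\<close>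

lemma consistent_extends_to_outcome:
  assumes G: "game G" and h: "consistent G \<sigma> h" "hd h = s"
  obtains \<pi> where "\<pi> \<in> dia_strategies G" "outcome_prefix G \<sigma> \<pi> s (length h - 1) = h"
proof -
  \<comment> \<open>\<open>\<pi>\<close> replays \<open>h\<close> by position: after
    \<open>length g\<close> states it proposes \<open>h ! length g\<close>. The edge test and the
    fallback keep it legal on histories that deviate from \<open>h\<close>.\<close>
  define \<pi> where "\<pi> g = (let x = h ! length g in
      if length g < length h \<and> (last g, x) \<in> edges G then x else some_succ G (last g))" for g
  have "\<pi> \<in> dia_strategies G"
    unfolding dia_strategies_def
  proof (rule strategiesI)
    fix g assume "last g \<in> dia G"
    then have "last g \<in> states G" using G by (auto simp: game_def)
    then show "(last g, \<pi> g) \<in> edges G" using some_succ[OF G] by (auto simp: \<pi>_def Let_def)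
  qed
  moreover have "outcome_prefix G \<sigma> \<pi> s n = take (Suc n) h" if "n < length h" for n
    using that
  proof (induction n)
    case 0
    then show ?case using h(2) by (cases h) auto
  next
    case (Suc n)
    let ?g = "take (Suc n) h"
    have g: "?g \<noteq> []" "take (Suc (Suc n)) h = ?g @ [h ! Suc n]"
      using Suc.prems by (cases h; auto simp: take_Suc_conv_app_nth)+
    have "consistent G \<sigma> (?g @ [h ! Suc n])"
      using consistent_take[OF h(1), of "Suc (Suc n)"] g(2) by simp
    then have "(last ?g, h ! Suc n) \<in> edges G" "last ?g \<in> box G \<longrightarrow> \<sigma> ?g = h ! Suc n"
      using consistent_snoc[OF G g(1)] by auto
    then show ?case
      using Suc g by (auto simp: Let_def \<pi>_def min_def)
  qed
  from this[of "length h - 1"] have "outcome_prefix G \<sigma> \<pi> s (length h - 1) = h"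
    using consistent_nonempty[OF h(1)] by (cases h) auto
  ultimately show ?thesis using that by blast
qed

section \<open>The permissive scheme of a safety monitor\<close>

text \<open>The memory summarises the states strictly before the current one. So
  \<open>(s, m)\<close> is followed by memory \<open>upd s m\<close> whichever successor is chosen,
  while \<open>safe s m\<close> may still inspect the current state.\<close>

locale safety_monitor =
  fixes G :: "'s game" and Mm :: "'m set" and upd :: "'s \<Rightarrow> 'm \<Rightarrow> 'm" and m0 :: 'm
    and safe :: "'s \<Rightarrow> 'm \<Rightarrow> bool"
  assumes G: "game G" and fin_states: "finite (states G)" and fin_Mm: "finite Mm"
    and m0: "m0 \<in> Mm" and upd: "\<And>s m. s \<in> states G \<Longrightarrow> m \<in> Mm \<Longrightarrow> upd s m \<in> Mm"
begin

text \<open>One round of the safety game on the product: the controllable predecessor of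
  \<open>X\<close>, cut down to \<open>X\<close>.\<close>

definition refine :: "('s \<times> 'm) set \<Rightarrow> ('s \<times> 'm) set" where
  "refine X = {(s, m) \<in> X. if s \<in> box G then \<exists>s'. (s, s') \<in> edges G \<and> (s', upd s m) \<in> X
                          else \<forall>s'. (s, s') \<in> edges G \<longrightarrow> (s', upd s m) \<in> X}"

definition safe_pairs :: "('s \<times> 'm) set" where
  "safe_pairs = {(s, m). s \<in> states G \<and> m \<in> Mm \<and> safe s m}"

text \<open>The greatest fixpoint in the form in which it is computed: the number of rounds is the
  size of the product, enough for stabilisation and known to a program in advance.\<close>

definition win :: "('s \<times> 'm) set" where
  "win = (refine ^^ (card (states G) * card Mm)) safe_pairs"

definition win_scheme :: "('s, 'm) scheme" where
  "win_scheme = \<lparr>Mem = Mm, Up = upd, Const = (\<lambda>s m. {s'. (s, s') \<in> edges G \<and> (s', upd s m) \<in> win}),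
     Init = (\<lambda>s. if (s, m0) \<in> win then Some m0 else None)\<rparr>"

lemma win_scheme_simps [simp]:
  "Mem win_scheme = Mm" "Up win_scheme = upd"
  "Const win_scheme s m = {s'. (s, s') \<in> edges G \<and> (s', upd s m) \<in> win}"
  "Init win_scheme s = (if (s, m0) \<in> win then Some m0 else None)"
  by (simp_all add: win_scheme_def)

lemma edge_states: "(s, s') \<in> edges G \<Longrightarrow> s \<in> states G \<and> s' \<in> states G"
  using G by (auto simp: game_def)

lemma box_or_dia: "s \<in> states G \<longleftrightarrow> s \<in> box G \<or> s \<in> dia G" "s \<in> dia G \<Longrightarrow> s \<notin> box G"
  using G by (auto simp: game_def)

lemma refine_subset: "refine X \<subseteq> X"
  by (auto simp: refine_def)

lemma refine_mono: "X \<subseteq> Y \<Longrightarrow> refine X \<subseteq> refine Y"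
  by (fastforce simp: refine_def split: if_splits)

lemma win_fixpoint: "refine win = win"
proof -
  have sub: "safe_pairs \<subseteq> states G \<times> Mm" by (auto simp: safe_pairs_def)
  have fin: "finite (states G \<times> Mm)" using fin_states fin_Mm by simp
  show ?thesis unfolding win_def
    by (rule funpow_deflating_fixpoint)
      (use refine_subset finite_subset[OF sub fin] card_mono[OF fin sub] in
        \<open>auto simp: card_cartesian_product\<close>)
qed

lemma win_subset: "win \<subseteq> safe_pairs"
proof -
  have "(refine ^^ i) safe_pairs \<subseteq> safe_pairs" for i
    by (induction i) (use refine_subset in auto)
  then show ?thesis by (simp add: win_def)
qed

text \<open>Coinduction: by monotonicity a self-supporting set survives every round.\<close>

lemma win_greatest:
  assumes "X \<subseteq> safe_pairs" "X \<subseteq> refine X"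
  shows "X \<subseteq> win"
proof -
  have "X \<subseteq> (refine ^^ i) safe_pairs" for i
  proof (induction i)
    case (Suc i)
    then show ?case using assms(2) refine_mono[OF Suc] by simp
  qed (use assms(1) in simp)
  then show ?thesis by (simp add: win_def)
qed

lemma win_box: "(s, m) \<in> win \<Longrightarrow> s \<in> box G \<Longrightarrow> \<exists>s'. (s, s') \<in> edges G \<and> (s', upd s m) \<in> win"
  using win_fixpoint unfolding refine_def by (smt (verit, best) case_prodD mem_Collect_eq)

lemma win_dia: "(s, m) \<in> win \<Longrightarrow> s \<notin> box G \<Longrightarrow> (s, s') \<in> edges G \<Longrightarrow> (s', upd s m) \<in> win"
  using win_fixpoint unfolding refine_def by (smt (verit, best) case_prodD mem_Collect_eq)

text \<open>Box moves stay in \<open>win\<close> by the choice of \<open>Const\<close>, the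
  opponent's moves because \<open>win\<close> is a fixpoint. With \<open>win_box\<close>,
  \<open>Const\<close> can then be empty only at unreachable pairs.\<close>

lemma Reach_win: "(s, m) \<in> Reach G win_scheme \<Longrightarrow> (s, m) \<in> win"
proof (induction rule: Reach.induct)
  case (init s m)
  then show ?case by (auto split: if_splits)
next
  case (step s m s')
  then show ?case using win_dia by (cases "s \<in> box G") auto
qed

lemma strategy_scheme_win: "strategy_scheme G win_scheme"
  using fin_Mm m0 upd win_box Reach_win
  by (auto simp: strategy_scheme_def split: if_splits)

lemma scheme_edge_iff:
  "((s, m), (s', m')) \<in> edges (scheme_game G win_scheme) \<longleftrightarrow> m \<in> Mm \<and>
     (s \<in> dia G \<and> (s, s') \<in> edges G \<and> m' = upd s m \<or>
      s \<in> box G \<and> (s, s') \<in> edges G \<and> (s', m') \<in> win \<and> m' = upd s m \<or>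
      s \<in> box G \<and> s' = s \<and> m' = m \<and> (\<forall>s''. (s, s'') \<in> edges G \<longrightarrow> (s'', upd s m) \<notin> win))"
  by (auto simp: scheme_game_def)

lemma scheme_game_simps [simp]:
  "states (scheme_game G win_scheme) = states G \<times> Mm"
  "box (scheme_game G win_scheme) = box G \<times> Mm"
  "dia (scheme_game G win_scheme) = dia G \<times> Mm"
  by (simp_all add: scheme_game_def)

lemma game_scheme_game: "game (scheme_game G win_scheme)"
proof -
  have "\<exists>x. ((s, m), x) \<in> edges (scheme_game G win_scheme)" if "s \<in> states G" "m \<in> Mm" for s m
  proof (cases "s \<in> box G \<and> (\<forall>s'. (s, s') \<in> edges G \<longrightarrow> (s', upd s m) \<notin> win)")
    case True
    then have "((s, m), (s, m)) \<in> edges (scheme_game G win_scheme)"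
      using that by (simp add: scheme_edge_iff)
    then show ?thesis ..
  next
    case False
    have "\<exists>s'. (s, s') \<in> edges G \<and> (s \<in> dia G \<or> s \<in> box G \<and> (s', upd s m) \<in> win)"
    proof (cases "s \<in> box G")
      case False
      then have "s \<in> dia G" using box_or_dia(1) that(1) by simp
      then show ?thesis using some_succ[OF G that(1)] by auto
    qed (use \<open>\<not> (s \<in> box G \<and> _)\<close> in auto)
    then obtain s' where "(s, s') \<in> edges G" "s \<in> dia G \<or> s \<in> box G \<and> (s', upd s m) \<in> win"
      by auto
    then have "((s, m), (s', upd s m)) \<in> edges (scheme_game G win_scheme)"
      unfolding scheme_edge_iff using that(2) by blast
    then show ?thesis ..
  qed
  moreover have "s \<in> states G \<and> m \<in> Mm \<and> s' \<in> states G \<and> m' \<in> Mm"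
    if "((s, m), (s', m')) \<in> edges (scheme_game G win_scheme)" for s m s' m'
    using that upd[of s m] edge_states[of s s'] box_or_dia(1)[of s] unfolding scheme_edge_iff by blast
  then have "edges (scheme_game G win_scheme) \<subseteq> (states G \<times> Mm) \<times> (states G \<times> Mm)"
    by auto
  ultimately show ?thesis
    using G m0 unfolding game_def scheme_game_simps by blast
qed

text \<open>Self-loops are added to the scheme game where \<open>Const\<close> is empty, which
  \<open>win_box\<close> excludes inside \<open>win\<close>. From a winning pair every move thus
  follows an edge of \<open>G\<close> and stays winning.\<close>

lemma scheme_edge_win:
  assumes "(s, m) \<in> win" "((s, m), (s', m')) \<in> edges (scheme_game G win_scheme)"
  shows "(s, s') \<in> edges G" "m' = upd s m" "(s', m') \<in> win"
proof -
  have *: "(s, s') \<in> edges G \<and> m' = upd s m \<and> (s', m') \<in> win"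
    using assms(2) win_dia[OF assms(1), of s'] win_box[OF assms(1)] box_or_dia(2)[of s]
    unfolding scheme_edge_iff by metis
  show "(s, s') \<in> edges G" using * by simp
  show "m' = upd s m" using * by simp
  show "(s', m') \<in> win" using * by metis
qed

text \<open>The memory is a function of the states read, so histories of \<open>G\<close> lift
  uniquely. While play stays in \<open>win\<close>, \<open>annotate\<close> inverts
  \<open>map fst\<close>, which lets strategies be transferred.\<close>

definition annotate :: "'s list \<Rightarrow> ('s \<times> 'm) list" where
  "annotate h = map (\<lambda>i. (h ! i, fold upd (take i h) m0)) [0..<length h]"

lemma annotate_single [simp]: "annotate [s] = [(s, m0)]"
  by (simp add: annotate_def)

lemma annotate_snoc: "annotate (h @ [s]) = annotate h @ [(s, fold upd h m0)]"
  by (simp add: annotate_def nth_append)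

lemma map_fst_annotate [simp]: "map fst (annotate h) = h"
  by (induction h rule: rev_induct) (simp_all add: annotate_snoc, simp add: annotate_def)

lemma annotate_eq_Nil [simp]: "annotate h = [] \<longleftrightarrow> h = []"
  by (simp add: annotate_def)

lemma last_annotate: "h \<noteq> [] \<Longrightarrow> last (annotate h) = (last h, fold upd (butlast h) m0)"
  by (cases h rule: rev_cases) (simp_all add: annotate_snoc)

lemma fold_butlast: "h \<noteq> [] \<Longrightarrow> upd (last h) (fold upd (butlast h) m0) = fold upd h m0"
  by (cases h rule: rev_cases) simp_all

end

section \<open>Transfer of strategies for a monitored objective\<close>

locale safety_monitor_for = safety_monitor +
  fixes \<Phi> :: "(nat \<Rightarrow> 'a) set"
  assumes objective:
    "\<And>w. w \<in> \<Phi> \<longleftrightarrow> run G w \<and> (\<forall>t. safe (w t) (fold upd (map w [0..<t]) m0))"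
begin

lemma achieving_consistent_win:
  assumes \<sigma>: "\<sigma> \<in> achieving_strategies G \<Phi> s" and h: "consistent G \<sigma> h" "hd h = s"
  shows "(last h, fold upd (butlast h) m0) \<in> win"
proof -
  \<comment> \<open>End pairs of all histories consistent with \<open>\<sigma>\<close>: the
    candidate for the coinduction.\<close>
  define X where "X = {(last h, fold upd (butlast h) m0) | h. consistent G \<sigma> h \<and> hd h = s}"
  have fold_Mm: "fold upd g m \<in> Mm" if "set g \<subseteq> states G" "m \<in> Mm" for g m
    using that by (induction g arbitrary: m) (auto simp: upd)
  have "X \<subseteq> safe_pairs"
  proof
    fix x assume "x \<in> X"
    then obtain g where g: "x = (last g, fold upd (butlast g) m0)" "consistent G \<sigma> g" "hd g = s"
      by (auto simp: X_def)
    obtain \<pi> where \<pi>: "\<pi> \<in> dia_strategies G" "outcome_prefix G \<sigma> \<pi> s (length g - 1) = g"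
      using consistent_extends_to_outcome[OF G g(2,3)] by blast
    let ?w = "outcome G \<sigma> \<pi> s"
    have "?w \<in> \<Phi>" using \<sigma> \<pi>(1) by (simp add: achieving_strategies_def achieves_def)
    then have "safe (?w (length g - 1)) (fold upd (map ?w [0..<length g - 1]) m0)"
      by (simp add: objective)
    moreover have "g = map ?w [0..<Suc (length g - 1)]"
      using \<pi>(2) unfolding outcome_prefix_eq_map by simp
    then have "g = map ?w [0..<length g - 1] @ [?w (length g - 1)]" by simp
    then have "butlast g = map ?w [0..<length g - 1]" "last g = ?w (length g - 1)"
      by (metis butlast_snoc, metis last_snoc)
    moreover have "set (butlast g) \<subseteq> states G"
      using consistent_states[OF g(2)] by (meson in_set_butlastD subset_iff)
    ultimately show "x \<in> safe_pairs"
      using consistent_last[OF g(2)] fold_Mm[OF _ m0, of "butlast g"] g(1)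
      by (auto simp: safe_pairs_def)
  qed
  moreover have "X \<subseteq> refine X"
  proof
    fix x assume "x \<in> X"
    then obtain g where g: "x = (last g, fold upd (butlast g) m0)" "consistent G \<sigma> g" "hd g = s"
      by (auto simp: X_def)
    have ne: "g \<noteq> []" using g(2) by (rule consistent_nonempty)
    \<comment> \<open>A history can be prolonged by the move of \<open>\<sigma>\<close> at a box
      state and by every edge elsewhere: the two cases of \<open>refine\<close>.\<close>
    have ext: "(s', upd (last g) (fold upd (butlast g) m0)) \<in> X"
      if "(last g, s') \<in> edges G" "last g \<in> box G \<Longrightarrow> \<sigma> g = s'" for s'
      using that g ne consistent_snoc[OF G ne, of \<sigma> s']
      by (auto simp: X_def fold_butlast intro!: exI[of _ "g @ [s']"])
    show "x \<in> refine X"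
    proof (cases "last g \<in> box G")
      case True
      then have "(last g, \<sigma> g) \<in> edges G"
        using strategies_move[OF _ ne consistent_states[OF g(2)], of \<sigma> "box G"] \<sigma>
        by (simp add: achieving_strategies_def box_strategies_def)
      then show ?thesis using ext[of "\<sigma> g"] True \<open>x \<in> X\<close> g(1) by (auto simp: refine_def)
    next
      case False
      then show ?thesis using ext \<open>x \<in> X\<close> g(1) by (auto simp: refine_def)
    qed
  qed
  ultimately have "X \<subseteq> win" by (rule win_greatest)
  then show ?thesis using h by (auto simp: X_def)
qed

lemma achieving_init_win:
  assumes "\<sigma> \<in> achieving_strategies G \<Phi> s" "s \<in> states G"
  shows "(s, m0) \<in> win"
  using achieving_consistent_win[OF assms(1), of "[s]"] assms(2) by (simp add: consistent_single)

lemma achieving_admitted: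
  assumes \<sigma>: "\<sigma> \<in> achieving_strategies G \<Phi> s" and s: "s \<in> states G"
  shows "admitted G win_scheme s \<sigma>"
proof -
  have "h ! Suc i \<in> Const win_scheme (h ! i) (fold upd (take i h) m0)"
    if h: "consistent G \<sigma> h" "hd h = s" "Suc i < length h" for h i
  proof -
    let ?g = "take (Suc (Suc i)) h"
    have g: "?g = take (Suc i) h @ [h ! Suc i]" "take (Suc i) h = take i h @ [h ! i]"
      using h(3) by (simp_all add: take_Suc_conv_app_nth)
    have "hd ?g = s" using h by (cases h) auto
    then have "(last ?g, fold upd (butlast ?g) m0) \<in> win"
      using achieving_consistent_win[OF \<sigma>] consistent_take[OF h(1)] by simp
    moreover have "last ?g = h ! Suc i" "butlast ?g = take (Suc i) h"
      unfolding g(1) by (rule last_snoc, rule butlast_snoc)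
    moreover have "fold upd (take (Suc i) h) m0 = upd (h ! i) (fold upd (take i h) m0)"
      by (simp add: g(2))
    ultimately have "(h ! Suc i, upd (h ! i) (fold upd (take i h) m0)) \<in> win"
      by simp
    moreover have "(h ! i, h ! Suc i) \<in> edges G"
      using h by (simp add: consistent_def finite_path_def)
    ultimately show ?thesis by simp
  qed
  then show ?thesis using achieving_init_win[OF assms] by (auto simp: admitted_def)
qed

lemma achieving_lift:
  assumes \<sigma>: "\<sigma> \<in> achieving_strategies G \<Phi> s" and s: "s \<in> states G"
  shows "\<exists>\<tau>\<in>box_strategies (scheme_game G win_scheme).
    strategy_equiv (scheme_game G win_scheme) (s, m0) (lift_strategy win_scheme \<sigma>) \<tau>"
proof -
  let ?H = "scheme_game G win_scheme" and ?l = "lift_strategy win_scheme \<sigma>"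
  \<comment> \<open>The lifted moves need not be edges on arbitrary histories. The fallback repairs
    this, and the rest shows that it is not taken on histories from \<open>(s, m0)\<close>
    consistent with \<open>?l\<close>.\<close>
  define \<tau> where "\<tau> h = (if (last h, ?l h) \<in> edges ?H then ?l h else some_succ ?H (last h))" for h
  have "\<tau> \<in> box_strategies ?H"
    unfolding box_strategies_def
  proof (rule strategiesI)
    fix h :: "('a \<times> 'b) list" assume "last h \<in> box ?H"
    then have "last h \<in> states ?H" using box_or_dia by auto
    then show "(last h, \<tau> h) \<in> edges ?H"
      using some_succ[OF game_scheme_game] by (simp add: \<tau>_def)
  qed
  \<comment> \<open>Each pair met on the way is winning, so the scheme game moves along edges of
    \<open>G\<close> and updates the memory as \<open>fold upd\<close> does.\<close>
  moreover have cons: "hd h = (s, m0) \<longrightarrow> consistent G \<sigma> (map fst h) \<and> hd (map fst h) = s \<and>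
      snd (last h) = fold upd (butlast (map fst h)) m0" if "consistent ?H ?l h" for h
    using game_scheme_game that
  proof (induction rule: consistent_induct)
    case (single x)
    then show ?case using s by (auto simp: consistent_single)
  next
    case (snoc h y)
    show ?case
    proof
      assume "hd (h @ [y]) = (s, m0)"
      then have IH: "consistent G \<sigma> (map fst h)" "hd (map fst h) = s"
        "snd (last h) = fold upd (butlast (map fst h)) m0" using snoc by auto
      have lst: "last (map fst h) = fst (last h)" using snoc.hyps(1) by (simp add: last_map)
      have win: "(fst (last h), snd (last h)) \<in> win"
        using achieving_consistent_win[OF \<sigma> IH(1,2)] IH(3) lst by simp
      have "(fst (last h), fst y) \<in> edges G" "snd y = upd (fst (last h)) (snd (last h))"
        using scheme_edge_win[OF win, of "fst y" "snd y"] snoc.hyps(3) by simp_all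
      moreover have "\<sigma> (map fst h) = fst y" if "fst (last h) \<in> box G"
      proof -
        have "last h \<in> box ?H"
          using that win win_subset by (cases "last h") (auto simp: safe_pairs_def)
        then show ?thesis using snoc.hyps(4) by (auto simp: lift_strategy_def)
      qed
      ultimately show "consistent G \<sigma> (map fst (h @ [y])) \<and> hd (map fst (h @ [y])) = s \<and>
          snd (last (h @ [y])) = fold upd (butlast (map fst (h @ [y]))) m0"
        using IH snoc.hyps(1) consistent_snoc[OF G, of "map fst h" \<sigma> "fst y"] lst
          fold_butlast[of "map fst h"]
        by (auto simp: hd_append)
    qed
  qed
  have "?l h = \<tau> h" if h: "consistent ?H ?l h" "hd h = (s, m0)" "last h \<in> box ?H" for h
  proof -
    let ?g = "map fst h"
    have c: "consistent G \<sigma> ?g" "hd ?g = s" "snd (last h) = fold upd (butlast ?g) m0"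
      using cons[OF h(1)] h(2) by auto
    have ne: "?g \<noteq> []" using consistent_nonempty[OF c(1)] .
    have lst: "last ?g = fst (last h)" using ne by (simp add: last_map)
    have bx: "last ?g \<in> box G" using h(3) lst by (cases "last h") simp
    have e: "(last ?g, \<sigma> ?g) \<in> edges G"
      using strategies_move[OF _ ne consistent_states[OF c(1)], of \<sigma> "box G"] \<sigma> bx
      by (simp add: achieving_strategies_def box_strategies_def)
    have "consistent G \<sigma> (?g @ [\<sigma> ?g])" using c e by (simp add: consistent_snoc[OF G ne])
    from achieving_consistent_win[OF \<sigma> this] have "(\<sigma> ?g, fold upd ?g m0) \<in> win"
      using c(2) ne by (simp add: hd_append)
    moreover have "fold upd ?g m0 = upd (fst (last h)) (snd (last h))"
      using fold_butlast[OF ne] c(3) lst by simp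
    ultimately have "(last h, ?l h) \<in> edges ?H"
      using e bx h(3) lst by (cases "last h") (simp add: lift_strategy_def scheme_edge_iff)
    then show ?thesis by (simp add: \<tau>_def)
  qed
  ultimately show ?thesis by (auto simp: strategy_equiv_def)
qed

lemma scheme_strategy_projects:
  assumes \<tau>: "\<tau> \<in> box_strategies (scheme_game G win_scheme)" and s: "(s, m0) \<in> win"
  shows "\<exists>\<sigma>\<in>achieving_strategies G \<Phi> s. projects_to G win_scheme \<tau> s \<sigma>"
proof -
  let ?H = "scheme_game G win_scheme"
  \<comment> \<open>The memory is recomputed from the states before \<open>\<tau>\<close> is
    consulted; the fallback makes the result a strategy on all sequences.\<close>
  define \<sigma> where "\<sigma> h = (let x = fst (\<tau> (annotate h)) in
     if (last h, x) \<in> edges G then x else some_succ G (last h))" for h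
  have \<sigma>_box: "\<sigma> \<in> box_strategies G"
    unfolding box_strategies_def
  proof (rule strategiesI)
    fix h :: "'a list" assume "last h \<in> box G"
    then have "last h \<in> states G" using box_or_dia by auto
    then show "(last h, \<sigma> h) \<in> edges G"
      using some_succ[OF G] by (simp add: \<sigma>_def Let_def)
  qed
  have H: "hd h = (s, m0) \<longrightarrow> h = annotate (map fst h) \<and> last h \<in> win"
    if "consistent ?H \<tau> h" for h
    using game_scheme_game that
  proof (induction rule: consistent_induct)
    case (single x)
    then show ?case using s by auto
  next
    case (snoc h y)
    show ?case
    proof
      assume "hd (h @ [y]) = (s, m0)"
      then have IH: "h = annotate (map fst h)" "last h \<in> win" using snoc by auto
      have ne: "map fst h \<noteq> []" using snoc.hyps(1) by simp
      have "last h = (last (map fst h), fold upd (butlast (map fst h)) m0)"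
        using last_annotate[OF ne] IH(1) by simp
      then have "upd (fst (last h)) (snd (last h)) = fold upd (map fst h) m0"
        using fold_butlast[OF ne] by simp
      moreover have "((fst (last h), snd (last h)), (fst y, snd y)) \<in> edges ?H"
        using snoc.hyps(3) by simp
      note scheme_edge_win[OF _ this]
      ultimately have "y = (fst y, fold upd (map fst h) m0)" "y \<in> win"
        using IH(2) by (metis prod.collapse)+
      then show "h @ [y] = annotate (map fst (h @ [y])) \<and> last (h @ [y]) \<in> win"
        using IH(1) by (simp add: annotate_snoc)
    qed
  qed
  have \<sigma>_eq: "\<sigma> (map fst h) = fst (\<tau> h) \<and> (last h, \<tau> h) \<in> edges ?H"
    if h: "consistent ?H \<tau> h" "hd h = (s, m0)" "last h \<in> box ?H" for h
  proof -
    have "h \<noteq> []" using consistent_nonempty[OF h(1)] .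
    then have e: "(last h, \<tau> h) \<in> edges ?H"
      using strategies_move[OF _ _ consistent_states[OF h(1)] h(3), of \<tau>] \<tau> by (simp add: box_strategies_def)
    then have "(fst (last h), fst (\<tau> h)) \<in> edges G"
      using H[OF h(1)] h(2) scheme_edge_win(1)[of "fst (last h)" "snd (last h)" "fst (\<tau> h)" "snd (\<tau> h)"]
      by simp
    then show ?thesis
      using e H[OF h(1)] h(2) \<open>h \<noteq> []\<close> by (simp add: \<sigma>_def last_map)
  qed
  have "projects_to G win_scheme \<tau> s \<sigma>"
    unfolding projects_to_def using \<sigma>_box \<sigma>_eq s by (auto simp: prod_eq_iff)
  moreover have "outcome G \<sigma> \<pi> s \<in> \<Phi>" if \<pi>: "\<pi> \<in> dia_strategies G" for \<pi>
  proof -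
    have s_states: "s \<in> states G" using s win_subset by (auto simp: safe_pairs_def)
    let ?w = "outcome G \<sigma> \<pi> s" and ?p = "outcome_prefix G \<sigma> \<pi> s"
    \<comment> \<open>Converse of \<open>H\<close>: a history of \<open>G\<close> is lifted, and
      \<open>\<sigma>_eq\<close> identifies the moves at box states. Every outcome prefix thus ends
      in a winning, hence safe, pair.\<close>
    have ann: "hd h = s \<longrightarrow> consistent ?H \<tau> (annotate h) \<and> hd (annotate h) = (s, m0)"
      if "consistent G \<sigma> h" for h
      using G that
    proof (induction rule: consistent_induct)
      case (single x)
      then show ?case using m0 by (auto simp: consistent_single)
    next
      case (snoc h x)
      show ?case
      proof
        assume "hd (h @ [x]) = s"
        then have IH: "consistent ?H \<tau> (annotate h)" "hd (annotate h) = (s, m0)" using snoc by auto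
        have ne: "annotate h \<noteq> []" using snoc.hyps(1) by simp
        note lst = last_annotate[OF snoc.hyps(1)]
        have st: "last (annotate h) \<in> states ?H" using consistent_last[OF IH(1)] .
        have win: "last (annotate h) \<in> win" using H[OF IH(1)] IH(2) by simp
        have "(last (annotate h), (x, fold upd h m0)) \<in> edges ?H \<and>
            (last (annotate h) \<in> box ?H \<longrightarrow> \<tau> (annotate h) = (x, fold upd h m0))"
        proof (cases "last h \<in> box G")
          case True
          then have bx: "last (annotate h) \<in> box ?H" using lst st by auto
          note eq = \<sigma>_eq[OF IH bx]
          have "snd (\<tau> (annotate h)) = fold upd h m0"
            using scheme_edge_win(2)[of "last h" "fold upd (butlast h) m0" "fst (\<tau> (annotate h))"
                "snd (\<tau> (annotate h))"] eq lst win fold_butlast[OF snoc.hyps(1)] by simp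
          then have "\<tau> (annotate h) = (x, fold upd h m0)"
            using eq snoc.hyps(4)[OF True] by (simp add: prod_eq_iff)
          then show ?thesis using eq by simp
        next
          case False
          then show ?thesis
            using st snoc.hyps(3) fold_butlast[OF snoc.hyps(1)] box_or_dia by (simp add: lst scheme_edge_iff)
        qed
        then show "consistent ?H \<tau> (annotate (h @ [x])) \<and> hd (annotate (h @ [x])) = (s, m0)"
          using IH ne by (simp add: annotate_snoc consistent_snoc[OF game_scheme_game ne])
      qed
    qed
    have "safe (?w t) (fold upd (map ?w [0..<t]) m0)" for t
    proof -
      have "consistent G \<sigma> (?p t)" "hd (?p t) = s"
        using outcome_prefix_consistent[OF G s_states \<sigma>_box \<pi>]
        by (simp_all add: hd_outcome_prefix)
      then have "consistent ?H \<tau> (annotate (?p t))" "hd (annotate (?p t)) = (s, m0)"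
        using ann by auto
      then have "last (annotate (?p t)) \<in> win" using H by blast
      then show ?thesis
        using win_subset last_annotate[OF outcome_prefix_nonempty, of G \<sigma> \<pi> s t]
        by (auto simp: outcome_prefix_eq_map safe_pairs_def)
    qed
    then show ?thesis
      using outcome_run[OF G s_states \<sigma>_box \<pi>] by (simp add: objective)
  qed
  ultimately show ?thesis
    using \<sigma>_box by (auto simp: achieving_strategies_def achieves_def)
qed

theorem permissive_win_scheme: "permissive G win_scheme \<Phi>"
  unfolding permissive_def strategies_match_def
proof (intro ballI conjI)
  fix s \<sigma> assume "s \<in> states G" "\<sigma> \<in> achieving_strategies G \<Phi> s"
  then show "admitted G win_scheme s \<sigma>" by (simp add: achieving_admitted)
  show "\<exists>\<tau>\<in>if Init win_scheme s = None then {} else box_strategies (scheme_game G win_scheme).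
    strategy_equiv (scheme_game G win_scheme) (s, the (Init win_scheme s)) (lift_strategy win_scheme \<sigma>) \<tau>"
    using achieving_lift achieving_init_win \<open>s \<in> states G\<close> \<open>\<sigma> \<in> achieving_strategies G \<Phi> s\<close> by simp
next
  fix s \<tau>
  assume "\<tau> \<in> (if Init win_scheme s = None then {} else box_strategies (scheme_game G win_scheme))"
  then have "\<tau> \<in> box_strategies (scheme_game G win_scheme)" "(s, m0) \<in> win"
    by (auto split: if_splits)
  \<comment> \<open>One strategy serves both as \<open>\<sigma>\<close> and as
    \<open>\<sigma>'\<close>, being equivalent to itself.\<close>
  from scheme_strategy_projects[OF this]
  show "\<exists>\<sigma>\<in>achieving_strategies G \<Phi> s. \<exists>\<sigma>'. projects_to G win_scheme \<tau> s \<sigma>' \<and> strategy_equiv G s \<sigma>' \<sigma>"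
    by (auto simp: strategy_equiv_def)
qed

end

section \<open>Positional numerals\<close>

lemma sum_digits_less:
  fixes d :: "nat \<Rightarrow> nat"
  assumes "\<And>j. j < K \<Longrightarrow> d j < B"
  shows "(\<Sum>j<K. d j * B ^ j) < B ^ K"
  using assms
proof (induction K)
  case (Suc K)
  then have "(\<Sum>j<K. d j * B ^ j) < B ^ K" by simp
  moreover have "d K \<le> B - 1" using Suc.prems[of K] by simp
  ultimately have "(\<Sum>j<K. d j * B ^ j) + d K * B ^ K < B ^ K + (B - 1) * B ^ K"
    by (intro add_less_le_mono mult_right_mono) auto
  also have "\<dots> = B ^ Suc K"
    using Suc.prems[of K] by (cases B) auto
  finally show ?case by simp
qed simp

text \<open>Division by \<open>B\<close> drops digit 0 and shifts the others down, so induction on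
  \<open>i\<close> applies to the shifted sequence.\<close>

lemma digit_sum_digits:
  fixes d :: "nat \<Rightarrow> nat"
  assumes "\<And>j. j < K \<Longrightarrow> d j < B" "i < K"
  shows "(\<Sum>j<K. d j * B ^ j) div B ^ i mod B = d i"
  using assms
proof (induction i arbitrary: d K)
  case (0 d K)
  then obtain K' where K: "K = Suc K'" by (cases K) auto
  have "(\<Sum>j<K. d j * B ^ j) = d 0 + B * (\<Sum>j<K'. d (Suc j) * B ^ j)"
    unfolding K by (subst sum.lessThan_Suc_shift) (simp add: sum_distrib_left mult_ac)
  then show ?case using 0 by simp
next
  case (Suc i d K)
  then obtain K' where K: "K = Suc K'" by (cases K) auto
  have "(\<Sum>j<K. d j * B ^ j) = d 0 + B * (\<Sum>j<K'. d (Suc j) * B ^ j)"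
    unfolding K by (subst sum.lessThan_Suc_shift) (simp add: sum_distrib_left mult_ac)
  moreover have "d 0 < B" using Suc.prems by auto
  ultimately have "(\<Sum>j<K. d j * B ^ j) div B = (\<Sum>j<K'. d (Suc j) * B ^ j)" by simp
  then show ?case
    using Suc.IH[of K' "\<lambda>j. d (Suc j)"] Suc.prems K by (simp add: div_mult2_eq)
qed

section \<open>A finite monitor for sliding windows\<close>

locale window_monitor =
  fixes S :: "'s set" and k W D M :: nat and \<rho> :: "'s \<Rightarrow> nat \<Rightarrow> nat" and \<mu> \<nu> :: "nat \<Rightarrow> rat"
  assumes k: "1 \<le> k" and W: "1 \<le> W" and D: "1 \<le> D" and D_dvd_W: "D dvd W"
    and \<rho>_le: "\<And>s i. s \<in> S \<Longrightarrow> i < k \<Longrightarrow> \<rho> s i \<le> M"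
begin

definition K :: nat where "K = k * (W div D)"
definition B :: nat where "B = max 1 (M * W)"
\<comment> \<open>Exceeds every value of the youngest open window; also serves as the offset that marks the
  start-up phase. There is room for it iff \<open>F < B\<close>; otherwise \<open>D = W\<close> or all rewards are 0, and
  checking windows that never opened does no harm.\<close>
definition F :: nat where "F = max 1 (M * D)"
definition N :: nat where "N = W * B ^ K"

text \<open>A memory element \<open>c + W * (\<Sum>j<K. d j * B ^ j)\<close> stores the clock \<open>c\<close> and, in digit
  \<open>q * k + i\<close>, dimension \<open>i\<close> of the window that opens when the clock shows \<open>q * D\<close>.
  It describes the situation before the current state is read.\<close>

definition digit :: "nat \<Rightarrow> nat \<Rightarrow> nat" where
  "digit m j = m div W div B ^ j mod B"

text \<open>Index of the youngest open window in dimension 0: its slot is the last one not after the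
  clock. This digit carries the start-up offset.\<close>

definition cur :: "nat \<Rightarrow> nat" where
  "cur m = k * (m mod W div D)"

definition nxt :: "nat \<Rightarrow> nat" where
  "nxt m = (m + 1) mod W"

text \<open>The condition \<open>nxt m \<noteq> 0\<close> switches checking on at time
  \<open>W - 1\<close>, when the window opened at time 0 receives its last state and must be
  judged.\<close>

definition startup :: "nat \<Rightarrow> bool" where
  "startup m \<longleftrightarrow> F \<le> digit m (cur m) \<and> nxt m \<noteq> 0"

text \<open>\<open>mod F\<close> removes the offset if present; otherwise it changes nothing along a
  run, where the youngest counter is below \<open>F\<close>.\<close>

definition tot :: "'s \<Rightarrow> nat \<Rightarrow> nat \<Rightarrow> nat" where
  "tot s m j = (if j = cur m then digit m j mod F else digit m j) + \<rho> s (j mod k)"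

text \<open>A window whose slot the clock reaches closes and reopens at once with 0. The offset,
  stripped by \<open>tot\<close>, is added again at the youngest window of the next step.
  \<open>mod B\<close> keeps \<open>upd\<close> inside the memory for arbitrary arguments; on a run
  it truncates no counter of an opened window.\<close>

definition new_digit :: "'s \<Rightarrow> nat \<Rightarrow> nat \<Rightarrow> nat" where
  "new_digit s m j = ((if nxt m = (j div k) * D then 0 else tot s m j) +
     (if startup m \<and> j = cur (nxt m) then F else 0)) mod B"

definition upd :: "'s \<Rightarrow> nat \<Rightarrow> nat" where
  "upd s m = nxt m + W * (\<Sum>j<K. new_digit s m j * B ^ j)"

definition in_bounds :: "nat \<Rightarrow> nat \<Rightarrow> bool" where
  "in_bounds i x \<longleftrightarrow> of_nat W * \<mu> i \<le> of_nat x \<and> of_nat x \<le> of_nat W * \<nu> i"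

text \<open>\<open>tot\<close> includes the current reward, so a closing window is judged with all
  its \<open>W\<close> rewards. Their sum may exceed every digit and is never stored.\<close>

definition safe :: "'s \<Rightarrow> nat \<Rightarrow> bool" where
  "safe s m \<longleftrightarrow> startup m \<or> (\<forall>j<K. nxt m = (j div k) * D \<longrightarrow> in_bounds (j mod k) (tot s m j))"

text \<open>Clock 0, the offset in digit 0, all other digits 0. \<open>F mod B\<close> is 0 exactly
  when \<open>F = B\<close>, that is, when no offset fits.\<close>

definition init_mem :: nat where
  "init_mem = W * (F mod B)"

lemma B_pos: "0 < B" and F_pos: "0 < F"
  by (simp_all add: B_def F_def)

lemma F_le_B: "F \<le> B"
proof -
  have "M * D \<le> M * W" using D_dvd_W W by (simp add: dvd_imp_le)
  then show ?thesis unfolding F_def B_def by linarith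
qed

lemma mod_B_less_power: "0 < j \<Longrightarrow> F mod B < B ^ j"
  using B_pos self_le_power[of B j] by (metis One_nat_def Suc_leI less_le_trans mod_less_divisor)

lemma W_eq: "W = W div D * D"
  using D_dvd_W by simp

lemma K_pos: "0 < K"
  using k W D D_dvd_W by (auto simp: K_def dvd_imp_le div_greater_zero_iff)

lemma N_pos: "0 < N"
  using W B_pos by (simp add: N_def)

lemma nxt_less: "nxt m < W"
  using W by (simp add: nxt_def)

lemma new_digit_less: "new_digit s m j < B"
  using B_pos by (simp add: new_digit_def)

lemma upd_mod: "upd s m mod W = nxt m"
  using nxt_less[of m] by (simp add: upd_def)

lemma digit_upd: "j < K \<Longrightarrow> digit (upd s m) j = new_digit s m j"
  using nxt_less[of m] by (simp add: upd_def digit_def digit_sum_digits new_digit_less)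

lemma upd_less: "upd s m < N"
proof -
  have "(\<Sum>j<K. new_digit s m j * B ^ j) < B ^ K"
    by (rule sum_digits_less) (rule new_digit_less)
  then have "Suc (\<Sum>j<K. new_digit s m j * B ^ j) \<le> B ^ K" by simp
  then have "W * Suc (\<Sum>j<K. new_digit s m j * B ^ j) \<le> N"
    unfolding N_def by (rule mult_le_mono2)
  then show ?thesis using nxt_less[of m] by (simp add: upd_def)
qed

lemma init_mem_less: "init_mem < N"
proof -
  have "F mod B < B ^ K"
    by (rule mod_B_less_power) (rule K_pos)
  then show ?thesis using W by (simp add: init_mem_def N_def)
qed

lemma slot_less: "j < K \<Longrightarrow> j div k * D < W"
proof -
  assume "j < K"
  then have "j div k < W div D" using k by (simp add: K_def div_less_iff_less_mult mult.commute)
  then have "j div k * D < W div D * D" using D by simp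
  then show ?thesis using W_eq by simp
qed

lemma cur_less: "cur m < K" and cur_div: "cur m div k = m mod W div D" and cur_mod: "cur m mod k = 0"
proof -
  have "m mod W < W div D * D" using W W_eq by simp
  then have "m mod W div D < W div D" using D by (simp add: div_less_iff_less_mult)
  then show "cur m < K" using k by (simp add: cur_def K_def)
qed (use k in \<open>simp_all add: cur_def\<close>)

end

section \<open>The monitor along a run\<close>

locale monitored_run = window_monitor +
  fixes w :: "nat \<Rightarrow> 'a"
  assumes w: "\<And>t. w t \<in> S"
begin

definition mem :: "nat \<Rightarrow> nat" where
  "mem t = fold upd (map w [0..<t]) init_mem"

lemma mem_0: "mem 0 = init_mem" and mem_Suc: "mem (Suc t) = upd (w t) (mem t)"
  by (simp_all add: mem_def)

text \<open>With slot \<open>j div k * D\<close>, the remainder modulo \<open>W\<close> is the age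
  of the window: the number of states read since it last opened, meaningful once the slot has been
  reached.\<close>

definition acc :: "nat \<Rightarrow> nat \<Rightarrow> nat" where
  "acc t j = (\<Sum>x\<in>{t - (t - j div k * D) mod W ..< t}. \<rho> (w x) (j mod k))"

lemma acc_le: "acc t j \<le> M * ((t - j div k * D) mod W)"
proof -
  let ?a = "(t - j div k * D) mod W"
  have "?a \<le> t" by (meson diff_le_self le_trans mod_less_eq_dividend)
  have "j mod k < k" using k by simp
  then have "acc t j \<le> of_nat (card {t - ?a ..< t}) * M"
    unfolding acc_def by (intro sum_bounded_above) (auto intro: \<rho>_le w)
  then show ?thesis using \<open>?a \<le> t\<close> by (simp add: mult.commute)
qed

lemma acc_less: "acc t j < B"
proof (cases "M = 0")
  case True
  then show ?thesis using acc_le[of t j] B_pos by simp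
next
  case False
  then have "M * ((t - j div k * D) mod W) < M * W" using W by simp
  then show ?thesis using acc_le[of t j] unfolding B_def by linarith
qed

text \<open>The age of the youngest window is the clock modulo \<open>D\<close>, hence at most
  \<open>D - 1\<close>.\<close>

lemma acc_cur_le: "acc t (cur t) \<le> M * (D - 1)"
proof -
  let ?q = "t mod W div D"
  have "t = W * (t div W) + t mod W" by simp
  moreover have "?q * D \<le> t mod W" by simp
  ultimately have "t - ?q * D = W * (t div W) + (t mod W - ?q * D)" by linarith
  then have "(t - ?q * D) mod W = (t mod W - ?q * D) mod W" by (simp only: mod_mult_self4)
  also have "\<dots> = t mod W mod D"
    using W by (metis less_imp_diff_less minus_div_mult_eq_mod mod_less mod_less_divisor One_nat_def Suc_le_lessD)
  also have "\<dots> \<le> D - 1" using D by (metis One_nat_def Suc_pred' less_Suc_eq_le mod_less_divisor Suc_le_lessD)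
  finally show ?thesis using acc_le[of t "cur t"] mult_le_mono2 le_trans by (metis cur_div)
qed

lemma acc_cur_less: "acc t (cur t) < F"
proof (cases "M = 0")
  case False
  then have "M * (D - 1) < M * D" using D by simp
  then show ?thesis using acc_cur_le[of t] unfolding F_def by linarith
qed (use acc_cur_le[of t] F_pos in simp)

text \<open>\<open>F < B\<close> forces \<open>M > 0\<close> and \<open>D < W\<close>, hence
  \<open>2 * D \<le> W\<close> by divisibility, and
  \<open>M * (D - 1) + M * D < 2 * M * D \<le> M * W\<close>.\<close>

lemma acc_cur_add_less:
  assumes "F < B"
  shows "acc t (cur t) + F < B"
proof -
  have M: "0 < M" using assms unfolding F_def B_def by (cases "M = 0") auto
  then have eq: "F = M * D" "B = M * W" using D W by (simp_all add: F_def B_def max_def Suc_leI)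
  obtain c where c: "W = D * c" using D_dvd_W by blast
  have "c \<noteq> 0" using W c by (cases c) auto
  moreover have "c \<noteq> 1" using assms eq c by auto
  ultimately have "2 \<le> c" by simp
  then have "D * 2 \<le> D * c" by (rule mult_le_mono2)
  then have "D + D \<le> W" unfolding c by linarith
  then have "M * (D + D) \<le> M * W" by (rule mult_le_mono2)
  moreover have "M * (D - 1) < M * D" using M D by simp
  ultimately show ?thesis using acc_cur_le[of t] eq unfolding add_mult_distrib2 by linarith
qed

lemma cur_cong: "a mod W = b mod W \<Longrightarrow> cur a = cur b"
  by (simp add: cur_def)

text \<open>The age wraps to 0 exactly when the clock meets the slot and grows by one otherwise. The
  second claim makes an induction hypothesis about opened windows applicable.\<close>

lemma acc_Suc:
  assumes j: "j < K" and le: "j div k * D \<le> Suc t"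
  shows "acc (Suc t) j = (if Suc t mod W = j div k * D then 0 else acc t j + \<rho> (w t) (j mod k))"
    and "Suc t mod W \<noteq> j div k * D \<Longrightarrow> j div k * D \<le> t"
proof -
  let ?s = "j div k * D"
  have reset: "Suc t mod W = ?s \<longleftrightarrow> (Suc t - ?s) mod W = 0"
    using slot_less[OF j] mod_eq_dvd_iff_nat[OF le, of W] by (simp add: dvd_eq_mod_eq_0)
  show "?s \<le> t" if "Suc t mod W \<noteq> ?s"
    using that le slot_less[OF j] by (cases "?s = Suc t") auto
  show "acc (Suc t) j = (if Suc t mod W = ?s then 0 else acc t j + \<rho> (w t) (j mod k))"
  proof (cases "Suc t mod W = ?s")
    case True
    then show ?thesis using reset by (simp add: acc_def)
  next
    case False
    then have st: "?s \<le> t" using \<open>Suc t mod W \<noteq> ?s \<Longrightarrow> ?s \<le> t\<close> by simp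
    then have "(Suc t - ?s) mod W = Suc ((t - ?s) mod W)"
      using False reset by (simp add: Suc_diff_le mod_Suc split: if_splits)
    moreover have "(t - ?s) mod W \<le> t" by (meson diff_le_self le_trans mod_less_eq_dividend)
    moreover have "\<not> t < t - (t - ?s) mod W" by simp
    ultimately show ?thesis using False by (simp add: acc_def sum.op_ivl_Suc)
  qed
qed

text \<open>The claims depend on each other: the clock locates the slots, the flag decides whether
  an offset is passed on, and the counters show that the digit carrying it does not overflow.
  Counters are described only for opened windows; whatever was collected earlier is cleared on
  opening.\<close>

lemma mem_invariant:
  "mem t mod W = t mod W"
  "F \<le> digit (mem t) (cur t) \<longleftrightarrow> t < W \<and> F < B"
  "j < K \<Longrightarrow> j div k * D \<le> t \<Longrightarrow>
     (if j = cur t then digit (mem t) j mod F else digit (mem t) j) = acc t j"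
proof -
  have "mem t mod W = t mod W \<and> (F \<le> digit (mem t) (cur t) \<longleftrightarrow> t < W \<and> F < B) \<and>
    (\<forall>j<K. j div k * D \<le> t \<longrightarrow>
       (if j = cur t then digit (mem t) j mod F else digit (mem t) j) = acc t j)"
  proof (induction t)
    case 0
    have cur0: "cur 0 = 0" by (simp add: cur_def)
    have "digit init_mem 0 = F mod B" using W by (simp add: digit_def init_mem_def)
    moreover have "digit init_mem j = 0" if "0 < j" for j
    proof -
      have "F mod B < B ^ j" using that by (rule mod_B_less_power)
      then show ?thesis using W by (simp add: digit_def init_mem_def)
    qed
    moreover have "F mod B = (if F < B then F else 0)" using F_le_B by auto
    ultimately show ?case
      using W D F_pos F_le_B by (auto simp: mem_0 init_mem_def cur0 acc_def)
  next
    case (Suc t)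
    let ?m = "mem t" and ?m' = "mem (Suc t)"
    have mod_eq: "?m mod W = t mod W" and flag: "F \<le> digit ?m (cur t) \<longleftrightarrow> t < W \<and> F < B"
      and digits: "\<And>j. j < K \<Longrightarrow> j div k * D \<le> t \<Longrightarrow>
        (if j = cur t then digit ?m j mod F else digit ?m j) = acc t j"
      using Suc by blast+
    have nxt: "nxt ?m = Suc t mod W"
      using mod_eq unfolding nxt_def Suc_eq_plus1[symmetric] by (metis mod_Suc_eq)
    have cur: "cur ?m = cur t" using mod_eq by (rule cur_cong)
    have cur': "cur (Suc t mod W) = cur (Suc t)" by (rule cur_cong) simp
    \<comment> \<open>At \<open>Suc t = W\<close> the stored flag is still set, but the clock wraps
      to 0; from then on no offset is passed on.\<close>
    have startup: "startup ?m \<longleftrightarrow> Suc t < W \<and> F < B"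
      using flag W unfolding startup_def nxt cur by (cases "Suc t = W") auto
    have dig: "digit ?m' j = (acc (Suc t) j + (if startup ?m \<and> j = cur (Suc t) then F else 0)) mod B"
      if j: "j < K" "j div k * D \<le> Suc t" for j
    proof -
      have "(if Suc t mod W = j div k * D then 0 else tot (w t) ?m j) = acc (Suc t) j"
        using acc_Suc[OF j] digits[OF j(1)] unfolding tot_def cur by simp
      then show ?thesis
        unfolding mem_Suc digit_upd[OF j(1)] new_digit_def nxt cur' by simp
    qed
    have dig_cur: "digit ?m' (cur (Suc t)) = acc (Suc t) (cur (Suc t)) + (if startup ?m then F else 0)"
    proof -
      have "cur (Suc t) div k * D \<le> Suc t"
        by (simp add: cur_div) (meson div_times_less_eq_dividend le_trans mod_less_eq_dividend)
      from dig[OF cur_less this] show ?thesis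
        using acc_less acc_cur_add_less[of "Suc t"] startup by simp
    qed
    show ?case
    proof (intro conjI allI impI)
      show "?m' mod W = Suc t mod W" by (simp add: mem_Suc upd_mod nxt)
      show "F \<le> digit ?m' (cur (Suc t)) \<longleftrightarrow> Suc t < W \<and> F < B"
        using dig_cur startup acc_cur_less[of "Suc t"] by auto
      fix j assume j: "j < K" "j div k * D \<le> Suc t"
      show "(if j = cur (Suc t) then digit ?m' j mod F else digit ?m' j) = acc (Suc t) j"
        using dig_cur dig[OF j] acc_cur_less[of "Suc t"] acc_less[of "Suc t" j] by auto
    qed
  qed
  then show "mem t mod W = t mod W" "F \<le> digit (mem t) (cur t) \<longleftrightarrow> t < W \<and> F < B"
    "j < K \<Longrightarrow> j div k * D \<le> t \<Longrightarrow>
       (if j = cur t then digit (mem t) j mod F else digit (mem t) j) = acc t j"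
    by blast+
qed

lemma nxt_mem: "nxt (mem t) = Suc t mod W"
  using mem_invariant(1)[of t] unfolding nxt_def Suc_eq_plus1[symmetric] by (metis mod_Suc_eq)

lemma cur_mem: "cur (mem t) = cur t"
  by (rule cur_cong) (rule mem_invariant)

lemma startup_mem: "startup (mem t) \<longleftrightarrow> Suc t < W \<and> F < B"
  using mem_invariant(2)[of t] W unfolding startup_def nxt_mem cur_mem by (cases "Suc t = W") auto

text \<open>Window \<open>l\<close> opens at \<open>l * D\<close>; at
  \<open>t = l * D + W - 1\<close> its age is \<open>W - 1\<close>. The digit holds all its rewards
  but the last, which \<open>tot\<close> adds.\<close>

lemma tot_mem:
  assumes "j < K" and t: "Suc t = l * D + W" and q: "(l * D) mod W = j div k * D"
  shows "tot (w t) (mem t) j = (\<Sum>x<W. \<rho> (w (l * D + x)) (j mod k))"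
proof -
  let ?s = "j div k * D"
  have "?s \<le> l * D" using q by (metis mod_less_eq_dividend)
  have "W dvd l * D - ?s" using q by (metis dvd_minus_mod)
  then obtain r where r: "l * D = ?s + W * r" using \<open>?s \<le> l * D\<close> by (metis dvdE le_add_diff_inverse)
  obtain W' where W': "W = Suc W'" using W by (cases W) auto
  have t': "t = l * D + W'" using t W' by simp
  have "t - ?s = W * r + W'" using r t' by simp
  then have "(t - ?s) mod W = W' mod W" by (simp only: mod_mult_self4)
  then have "(t - ?s) mod W = W'" using W' by simp
  moreover have "?s \<le> t" using \<open>?s \<le> l * D\<close> t' by linarith
  ultimately have "(if j = cur t then digit (mem t) j mod F else digit (mem t) j) =
      (\<Sum>x\<in>{l * D ..< t}. \<rho> (w x) (j mod k))"
    using mem_invariant(3)[OF assms(1), of t] t' by (simp only: acc_def) simp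
  then have "tot (w t) (mem t) j = (\<Sum>x\<in>{l * D ..< l * D + W'}. \<rho> (w x) (j mod k)) + \<rho> (w t) (j mod k)"
    using t' by (simp only: tot_def cur_mem)
  also have "\<dots> = (\<Sum>x\<in>{l * D ..< l * D + W}. \<rho> (w x) (j mod k))"
    by (simp add: W' t' sum.op_ivl_Suc)
  also have "\<dots> = (\<Sum>x<W. \<rho> (w (l * D + x)) (j mod k))"
    using sum.shift_bounds_nat_ivl[of "\<lambda>x. \<rho> (w x) (j mod k)" 0 "l * D" W]
    by (simp add: add.commute atLeast0LessThan)
  finally show ?thesis .
qed

lemma lmp_bounds:
  "\<mu> i \<le> lmp W D \<rho> l w i \<and> lmp W D \<rho> l w i \<le> \<nu> i \<longleftrightarrow> in_bounds i (\<Sum>x<W. \<rho> (w (l * D + x)) i)"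
  using W by (simp add: lmp_def in_bounds_def field_simps)

lemma safe_iff:
  "(\<forall>t. safe (w t) (mem t)) \<longleftrightarrow>
   (\<forall>l. \<forall>i<k. \<mu> i \<le> lmp W D \<rho> l w i \<and> lmp W D \<rho> l w i \<le> \<nu> i)" (is "?L = ?R")
proof
  assume L: ?L
  show ?R unfolding lmp_bounds
  proof (intro allI impI)
    fix l i assume i: "i < k"
    \<comment> \<open>The last time of window \<open>l\<close>, and its slot number among the
      \<open>W div D\<close> slots.\<close>
    let ?t = "l * D + W - 1" and ?q = "l mod (W div D)"
    let ?j = "?q * k + i"
    have t: "Suc ?t = l * D + W" using W by simp
    have j: "?j div k = ?q" "?j mod k = i" using i by simp_all
    have "0 < W div D" using K_pos k by (simp add: K_def)
    then have "Suc ?q \<le> W div D" by (simp add: Suc_leI)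
    then have "Suc ?q * k \<le> K" unfolding K_def by (metis mult.commute mult_le_mono2)
    then have jK: "?j < K" using i by simp
    have q: "(l * D) mod W = ?j div k * D"
      unfolding j using mult_mod_left[of l "W div D" D] W_eq by simp
    have "safe (w ?t) (mem ?t)" using L by blast
    moreover have "\<not> startup (mem ?t)" using t by (simp add: startup_mem)
    moreover have "nxt (mem ?t) = ?j div k * D"
      unfolding nxt_mem t using q by simp
    ultimately have "in_bounds (?j mod k) (tot (w ?t) (mem ?t) ?j)"
      using jK unfolding safe_def by blast
    then show "in_bounds i (\<Sum>x<W. \<rho> (w (l * D + x)) i)"
      unfolding tot_mem[OF jK t q] j .
  qed
next
  assume ?R
  then have R: "in_bounds i (\<Sum>x<W. \<rho> (w (l * D + x)) i)" if "i < k" for l i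
    using that unfolding lmp_bounds by blast
  show ?L
  proof
    fix t
    have "in_bounds (j mod k) (tot (w t) (mem t) j)"
      if ns: "\<not> startup (mem t)" and j: "j < K" and nxt: "nxt (mem t) = j div k * D" for j
    proof (cases "W \<le> Suc t")
      case True
      \<comment> \<open>\<open>a\<close> is the opening time of the closing window. It agrees with a
        slot modulo \<open>W\<close>, so it is a multiple of \<open>D\<close> and the window is one
        of the objective.\<close>
      then obtain a where a: "Suc t = a + W" by (metis add.commute le_Suc_ex)
      have aq: "a mod W = j div k * D" using nxt unfolding nxt_mem a by simp
      have "D dvd a mod W" unfolding aq by simp
      then have "D dvd a" using D_dvd_W by (metis dvd_mod_iff)
      then obtain l where l: "a = l * D" by (metis dvd_mult_div_cancel mult.commute)
      show ?thesis
        unfolding tot_mem[OF j a[unfolded l] aq[unfolded l]] by (rule R) (use k in simp)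
    next
      case False
      \<comment> \<open>A window that never opened is checked, so the offset did not fit.
        \<open>D = W\<close> would leave only slot 0, which the clock does not meet again before
        time \<open>W\<close>. Hence all rewards are 0 and window 0 of the objective gives the
        bound.\<close>
      then have "F = B" using ns F_le_B by (auto simp: startup_mem)
      have "M = 0"
      proof (rule ccontr)
        assume "M \<noteq> 0"
        then have "M * D = M * W" using \<open>F = B\<close> W D by (simp add: F_def B_def max_def split: if_splits)
        then have "D = W" using \<open>M \<noteq> 0\<close> by simp
        then have "j div k * D = 0" using slot_less[OF j] by simp
        then have "Suc t mod W = 0" using nxt nxt_mem by metis
        then show False using False by simp
      qed
      then have zero: "\<rho> s (j mod k) = 0" if "s \<in> S" for s
        using \<rho>_le[OF that, of "j mod k"] k by simp
      have "B = 1" "F = 1" unfolding B_def F_def by (simp_all add: \<open>M = 0\<close>)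
      then have "tot (w t) (mem t) j = 0" using zero[OF w] by (simp add: tot_def digit_def)
      then show ?thesis using R[of "j mod k" 0] zero[OF w] k by simp
    qed
    then show "safe (w t) (mem t)" unfolding safe_def by blast
  qed
qed

end

section \<open>Timed execution of programs\<close>

definition setv :: "name \<Rightarrow> int \<Rightarrow> store \<Rightarrow> store" where
  "setv x v s = s\<lparr>vars := (vars s)(x := v)\<rparr>"

definition seta :: "name \<Rightarrow> int \<Rightarrow> int \<Rightarrow> store \<Rightarrow> store" where
  "seta a i v s = s\<lparr>arrs := (arrs s)(a := (arrs s a)(i := v))\<rparr>"

lemma setv_simps [simp]:
  "vars (setv x v s) y = (if x = y then v else vars s y)" "arrs (setv x v s) = arrs s"
  by (simp_all add: setv_def)

lemma seta_simps [simp]: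
  "vars (seta a i v s) = vars s" "arrs (seta a i v s) b = (if a = b then (arrs s a)(i := v) else arrs s b)"
  by (simp_all add: seta_def)

text \<open>Total correctness with a time budget, for one start store. Budgets can be rounded up, so
  exact costs are not tracked through the program.\<close>

definition runs :: "prog \<Rightarrow> nat \<Rightarrow> store \<Rightarrow> (store \<Rightarrow> bool) \<Rightarrow> bool" where
  "runs P T s Q \<longleftrightarrow> (\<exists>t s'. exec P s t s' \<and> t \<le> T \<and> Q s')"

lemma runs_mono: "runs P T s Q \<Longrightarrow> T \<le> T' \<Longrightarrow> (\<And>s'. Q s' \<Longrightarrow> Q' s') \<Longrightarrow> runs P T' s Q'"
  unfolding runs_def using le_trans by blast

lemma runs_assign: "Q (setv x (eval_expr e s) s) \<Longrightarrow> runs (Assign x e) (1 + expr_cost e) s Q"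
  unfolding runs_def setv_def by (blast intro: exec.Assign)

lemma runs_store:
  "Q (seta a (eval_expr i s) (eval_expr e s) s) \<Longrightarrow>
   runs (Store a i e) (1 + expr_cost i + expr_cost e) s Q"
  unfolding runs_def seta_def by (blast intro: exec.Store)

lemma runs_seq:
  assumes "runs P T s R" "\<And>s'. R s' \<Longrightarrow> runs P' T' s' Q"
  shows "runs (Seq P P') (T + T') s Q"
proof -
  obtain t s' where 1: "exec P s t s'" "t \<le> T" "R s'" using assms(1) by (auto simp: runs_def)
  obtain t' s'' where 2: "exec P' s' t' s''" "t' \<le> T'" "Q s''"
    using assms(2)[OF 1(3)] by (auto simp: runs_def)
  show ?thesis unfolding runs_def using exec.Seq[OF 1(1) 2(1)] 1 2 by (meson add_le_mono)
qed

lemma runs_assign_seq: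
  "runs P T (setv x (eval_expr e s) s) Q \<Longrightarrow> runs (Seq (Assign x e) P) (1 + expr_cost e + T) s Q"
  by (rule runs_seq[OF runs_assign[where Q = "\<lambda>s'. s' = setv x (eval_expr e s) s"]]) simp_all

lemma runs_store_seq:
  "runs P T (seta a (eval_expr i s) (eval_expr e s) s) Q \<Longrightarrow>
   runs (Seq (Store a i e) P) (1 + expr_cost i + expr_cost e + T) s Q"
  by (rule runs_seq[OF runs_store[where Q = "\<lambda>s'. s' = seta a (eval_expr i s) (eval_expr e s) s"]])
    simp_all

lemma runs_le: "runs P T s Q \<Longrightarrow> T \<le> T' \<Longrightarrow> runs P T' s Q"
  by (rule runs_mono)

text \<open>In the \<open>_val\<close> rules the value is supplied in mathematical terms and
  evaluation is a separate goal, so stores do not accumulate nested expressions.\<close>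

lemma runs_assign_seq_val:
  "eval_expr e s = v \<Longrightarrow> runs P T (setv x v s) Q \<Longrightarrow> runs (Seq (Assign x e) P) (1 + expr_cost e + T) s Q"
  using runs_assign_seq by simp

lemma runs_store_seq_val:
  "eval_expr i s = iv \<Longrightarrow> eval_expr e s = v \<Longrightarrow> runs P T (seta a iv v s) Q \<Longrightarrow>
   runs (Seq (Store a i e) P) (1 + expr_cost i + expr_cost e + T) s Q"
  using runs_store_seq by simp

lemma runs_assign_val:
  "eval_expr e s = v \<Longrightarrow> Q (setv x v s) \<Longrightarrow> runs (Assign x e) (1 + expr_cost e) s Q"
  using runs_assign by simp

lemma runs_store_val:
  "eval_expr i s = iv \<Longrightarrow> eval_expr e s = v \<Longrightarrow> Q (seta a iv v s) \<Longrightarrow>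
   runs (Store a i e) (1 + expr_cost i + expr_cost e) s Q"
  using runs_store by simp

definition for_loop :: "name \<Rightarrow> name \<Rightarrow> prog \<Rightarrow> prog" where
  "for_loop x y P = Seq (Assign x (Num 0))
     (While (Bin Less (Var x) (Var y)) (Seq P (Assign x (Bin Add (Var x) (Num 1)))))"

text \<open>The constant 6 pays for the initialisation (2) and the failing test (4); each round adds
  a successful test (4) and the increment (4) to the body. The invariant ignores the loop variable,
  so the increment preserves it, and the body hands that variable back unchanged.\<close>

lemma runs_for:
  assumes I0: "I 0 s"
    and loop_var: "\<And>i v s. I i (setv x v s) \<longleftrightarrow> I i s"
    and bound: "\<And>i s. I i s \<Longrightarrow> vars s y = int n"
    and body: "\<And>i s. i < n \<Longrightarrow> I i s \<Longrightarrow> vars s x = int i \<Longrightarrow>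
      runs P T s (\<lambda>s. I (Suc i) s \<and> vars s x = int i)"
    and Q: "\<And>s. I n s \<Longrightarrow> Q s"
  shows "runs (for_loop x y P) (6 + n * (T + 8)) s Q"
proof -
  let ?b = "Bin Less (Var x) (Var y)" and ?inc = "Assign x (Bin Add (Var x) (Num 1))"
  let ?L = "While ?b (Seq P ?inc)"
  have "\<forall>s. I i s \<and> vars s x = int i \<longrightarrow> runs ?L (4 + d * (T + 8)) s Q" if "i + d = n" for i d
    using that
  proof (induction d arbitrary: i)
    case 0
    show ?case
    proof (intro allI impI)
      fix s assume s: "I i s \<and> vars s x = int i"
      then have "eval_expr ?b s = 0" using bound[of i s] 0 by simp
      from exec.WhileFalse[OF this] show "runs ?L (4 + 0 * (T + 8)) s Q"
        unfolding runs_def using Q[of s] s 0 by fastforce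
    qed
  next
    case (Suc d)
    show ?case
    proof (intro allI impI)
      fix s assume s: "I i s \<and> vars s x = int i"
      then have b: "eval_expr ?b s \<noteq> 0" using bound[of i s] Suc.prems by simp
      have "runs (Seq P ?inc) (T + 4) s (\<lambda>s. I (Suc i) s \<and> vars s x = int (Suc i))"
      proof (rule runs_mono[OF runs_seq[OF body[of i s]]])
        fix s' assume "I (Suc i) s' \<and> vars s' x = int i"
        then show "runs ?inc 4 s' (\<lambda>s. I (Suc i) s \<and> vars s x = int (Suc i))"
          by (intro runs_mono[OF runs_assign[where Q = "\<lambda>s. I (Suc i) s \<and> vars s x = int (Suc i)"]])
            (simp_all add: loop_var)
      qed (use s Suc.prems in simp_all)
      then obtain t s' where 1: "exec (Seq P ?inc) s t s'" "t \<le> T + 4"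
        "I (Suc i) s'" "vars s' x = int (Suc i)" by (auto simp: runs_def)
      have "runs ?L (4 + d * (T + 8)) s' Q" using Suc.IH[of "Suc i"] Suc.prems 1(3,4) by simp
      then obtain t' s'' where 2: "exec ?L s' t' s''" "t' \<le> 4 + d * (T + 8)" "Q s''"
        by (auto simp: runs_def)
      show "runs ?L (4 + Suc d * (T + 8)) s Q"
        unfolding runs_def using exec.WhileTrue[OF b 1(1) 2(1)] 1(2) 2(2,3)
        by (intro exI conjI) (assumption, auto)
    qed
  qed
  then have "runs ?L (4 + n * (T + 8)) (setv x 0 s) Q"
    using I0 loop_var by (metis add_0 of_nat_0 setv_simps(1))
  then have "runs ?L (4 + n * (T + 8)) (setv x (eval_expr (Num 0) s) s) Q" by simp
  from runs_assign_seq[OF this] show ?thesis by (simp add: for_loop_def)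
qed

lemma array_of_nth: "i < length xs \<Longrightarrow> array_of xs (int i) = xs ! i"
  by (simp add: array_of_def)

lemma div_less_of_less_mult: "x < n * (m::nat) \<Longrightarrow> x div m < n"
  by (simp add: less_mult_imp_div_less)

lemma index_less: "i < n \<Longrightarrow> d < k \<Longrightarrow> i * k + d < n * (k::nat)"
proof -
  assume "i < n" "d < k"
  then have "Suc i * k \<le> n * k" by (intro mult_le_mono1) simp
  then show ?thesis using \<open>d < k\<close> by simp
qed

text \<open>\<open>quotient_of\<close> has a positive denominator, so cross-multiplication turns
  rational bounds into integer tests. The negated strict form matches the operator
  \<open>Less\<close>.\<close>

lemma rat_le_quotient_of_iff:
  "of_int a \<le> of_int b * r \<longleftrightarrow> \<not> b * fst (quotient_of r) < a * snd (quotient_of r)"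
  "of_int b * r \<le> of_int a \<longleftrightarrow> \<not> a * snd (quotient_of r) < b * fst (quotient_of r)"
proof -
  obtain n d where nd: "quotient_of r = (n, d)" by (cases "quotient_of r")
  have r: "r = of_int n / of_int d" and d: "(of_int d :: rat) > 0"
    using quotient_of_div[OF nd] quotient_of_denom_pos[OF nd] by auto
  have "of_int a \<le> of_int b * r \<longleftrightarrow> (of_int (a * d) :: rat) \<le> of_int (b * n)"
    using d by (simp add: r field_simps)
  then show "of_int a \<le> of_int b * r \<longleftrightarrow> \<not> b * fst (quotient_of r) < a * snd (quotient_of r)"
    by (simp only: of_int_le_iff nd fst_conv snd_conv not_less)
  have "of_int b * r \<le> of_int a \<longleftrightarrow> (of_int (b * n) :: rat) \<le> of_int (a * d)"
    using d by (simp add: r field_simps)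
  then show "of_int b * r \<le> of_int a \<longleftrightarrow> \<not> a * snd (quotient_of r) < b * fst (quotient_of r)"
    by (simp only: of_int_le_iff nd fst_conv snd_conv not_less)
qed

section \<open>The program\<close>

abbreviation add_expr (infixl "[+]" 65) where "a [+] b \<equiv> Bin Add a b"
abbreviation sub_expr (infixl "[-]" 65) where "a [-] b \<equiv> Bin Sub a b"
abbreviation mul_expr (infixl "[*]" 70) where "a [*] b \<equiv> Bin Mul a b"
abbreviation div_expr (infixl "[div]" 70) where "a [div] b \<equiv> Bin Div a b"
abbreviation mod_expr (infixl "[mod]" 70) where "a [mod] b \<equiv> Bin Mod a b"
abbreviation less_expr (infix "[<]" 60) where "a [<] b \<equiv> Bin Less a b"
abbreviation eq_expr (infix "[=]" 60) where "a [=] b \<equiv> Bin Eq a b"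
abbreviation assign_prog (infix "::=" 56) where "x ::= e \<equiv> Assign x e"
abbreviation seq_prog (infixr ";;" 55) where "P ;; Q \<equiv> Seq P Q"

text \<open>The program computes with truth values 0 and 1 instead of branching, so the cost of
  straight-line code does not depend on the data.\<close>

definition not_expr :: "expr \<Rightarrow> expr" where
  "not_expr e = Num 1 [-] e"

definition max_one_expr :: "expr \<Rightarrow> expr" where
  "max_one_expr e = Num 1 [+] (Num 1 [<] e) [*] (e [-] Num 1)"

definition reward_prog :: prog where
  "reward_prog =
     ''SK'' ::= Var ''states'' [*] Var ''k'' ;;
     ''M'' ::= Num 0 ;;
     for_loop ''a'' ''SK''
       (''M'' ::= Var ''M'' [+] (Var ''M'' [<] Arr ''reward'' (Var ''a'')) [*]
          (Arr ''reward'' (Var ''a'') [-] Var ''M''))"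

definition power_prog :: prog where
  "power_prog =
     ''B'' ::= max_one_expr (Var ''M'' [*] Var ''W'') ;;
     ''F'' ::= max_one_expr (Var ''M'' [*] Var ''D'') ;;
     ''K'' ::= Var ''k'' [*] (Var ''W'' [div] Var ''D'') ;;
     ''P'' ::= Num 1 ;;
     for_loop ''j'' ''K''
       (Store ''pow'' (Var ''j'') (Var ''P'') ;;
        ''P'' ::= Var ''P'' [*] Var ''B'') ;;
     ''N'' ::= Var ''W'' [*] Var ''P'' ;;
     ''SN'' ::= Var ''states'' [*] Var ''N'' ;;
     ''EN'' ::= Var ''edges'' [*] Var ''N'' ;;
     ''I'' ::= Var ''W'' [*] (Var ''F'' [mod] Var ''B'')"

definition digit_prog :: prog where
  "digit_prog =
     ''t'' ::= Var ''v'' [div] Arr ''pow'' (Var ''j'') [mod] Var ''B'' ;;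
     ''t'' ::= Var ''t'' [-] (Var ''j'' [=] Var ''cur'') [*] (Var ''t'' [-] Var ''t'' [mod] Var ''F'') ;;
     ''d'' ::= Var ''j'' [mod] Var ''k'' ;;
     ''t'' ::= Var ''t'' [+] Arr ''reward'' (Var ''x'' [div] Var ''N'' [*] Var ''k'' [+] Var ''d'') ;;
     ''c'' ::= (Var ''nxt'' [=] Var ''j'' [div] Var ''k'' [*] Var ''D'') ;;
     ''bad'' ::= not_expr
        (not_expr (Var ''t'' [*] Arr ''mu_den'' (Var ''d'') [<] Var ''W'' [*] Arr ''mu_num'' (Var ''d'')) [*]
         not_expr (Var ''W'' [*] Arr ''nu_num'' (Var ''d'') [<] Var ''t'' [*] Arr ''nu_den'' (Var ''d''))) ;;
     ''ok'' ::= Var ''ok'' [*] not_expr (not_expr (Var ''su'') [*] Var ''c'' [*] Var ''bad'') ;;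
     ''acc'' ::= Var ''acc'' [+]
        (not_expr (Var ''c'') [*] Var ''t'' [+] Var ''su'' [*] (Var ''j'' [=] Var ''cur2'') [*] Var ''F'')
          [mod] Var ''B'' [*] Arr ''pow'' (Var ''j'')"

definition row_prog :: prog where
  "row_prog =
     ''m'' ::= Var ''x'' [mod] Var ''N'' ;;
     ''v'' ::= Var ''m'' [div] Var ''W'' ;;
     ''nxt'' ::= (Var ''m'' [+] Num 1) [mod] Var ''W'' ;;
     ''cur'' ::= Var ''k'' [*] (Var ''m'' [mod] Var ''W'' [div] Var ''D'') ;;
     ''cur2'' ::= Var ''k'' [*] (Var ''nxt'' [div] Var ''D'') ;;
     ''su'' ::= not_expr (Var ''v'' [div] Arr ''pow'' (Var ''cur'') [mod] Var ''B'' [<] Var ''F'') [*]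
        not_expr (Var ''nxt'' [=] Num 0) ;;
     ''acc'' ::= Num 0 ;;
     ''ok'' ::= Num 1 ;;
     for_loop ''j'' ''K'' digit_prog ;;
     Store ''up'' (Var ''x'') (Var ''nxt'' [+] Var ''W'' [*] Var ''acc'') ;;
     Store ''win'' (Var ''x'') (Var ''ok'')"

text \<open>State \<open>i\<close> with memory \<open>m\<close> has index \<open>i * N + m\<close>;
  the copy of edge \<open>e\<close> at memory \<open>m\<close> has index
  \<open>a = e * N + m\<close>.\<close>

definition source_expr :: expr where
  "source_expr = Arr ''src'' (Var ''a'' [div] Var ''N'') [*] Var ''N'' [+] Var ''a'' [mod] Var ''N''"

definition target_expr :: expr where
  "target_expr = Arr ''dst'' (Var ''a'' [div] Var ''N'') [*] Var ''N'' [+] Arr ''up'' source_expr"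

text \<open>\<open>u + t - u * t\<close> is disjunction and \<open>u * t\<close> conjunction: at a
  box state one surviving successor suffices, elsewhere all must survive.\<close>

definition edge_prog :: prog where
  "edge_prog =
     ''y'' ::= source_expr ;;
     ''t'' ::= Arr ''win'' target_expr ;;
     ''b'' ::= Arr ''box'' (Arr ''src'' (Var ''a'' [div] Var ''N'')) ;;
     Store ''new'' (Var ''y'')
       (Var ''b'' [*] (Arr ''new'' (Var ''y'') [+] Var ''t'' [-] Arr ''new'' (Var ''y'') [*] Var ''t'') [+]
        not_expr (Var ''b'') [*] (Arr ''new'' (Var ''y'') [*] Var ''t''))"

text \<open>\<open>new\<close> starts as the empty disjunction (0) or conjunction (1).
  \<open>win\<close> is overwritten only after the edge scan, so the scan reads the old set
  throughout.\<close>

definition refine_prog :: prog where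
  "refine_prog =
     for_loop ''x'' ''SN'' (Store ''new'' (Var ''x'') (not_expr (Arr ''box'' (Var ''x'' [div] Var ''N'')))) ;;
     for_loop ''a'' ''EN'' edge_prog ;;
     for_loop ''x'' ''SN'' (Store ''win'' (Var ''x'') (Arr ''win'' (Var ''x'') [*] Arr ''new'' (Var ''x'')))"

text \<open>For a bit \<open>b\<close>, \<open>b * (I + 1) - 1\<close> is \<open>I\<close> or the
  marker -1, again without a branch.\<close>

definition output_prog :: prog where
  "output_prog =
     for_loop ''a'' ''EN'' (Store ''const'' (Var ''a'') (Arr ''win'' target_expr)) ;;
     for_loop ''i'' ''states'' (Store ''init'' (Var ''i'')
       (Arr ''win'' (Var ''i'' [*] Var ''N'' [+] Var ''I'') [*] (Var ''I'' [+] Num 1) [-] Num 1))"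

definition window_prog :: prog where
  "window_prog =
     reward_prog ;; power_prog ;; for_loop ''x'' ''SN'' row_prog ;;
     for_loop ''r'' ''SN'' refine_prog ;; output_prog"

section \<open>Correctness of the program\<close>

locale window_game =
  fixes G :: "'s game" and k W D :: nat and \<rho> :: "'s \<Rightarrow> nat \<Rightarrow> nat" and \<mu> \<nu> :: "nat \<Rightarrow> rat"
  assumes wg: "game G" "finite (states G)" "1 \<le> k" "1 \<le> W" "1 \<le> D" "D dvd W"
begin

lemma finite_rewards: "finite {\<rho> s i | s i. s \<in> states G \<and> i < k}"
proof -
  have "{\<rho> s i | s i. s \<in> states G \<and> i < k} = (\<lambda>(s, i). \<rho> s i) ` (states G \<times> {..<k})" by auto
  then show ?thesis using wg(2) by simp
qed

sublocale window_monitor "states G" k W D "max_reward G k \<rho>" \<rho> \<mu> \<nu>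
proof
  fix s i assume "s \<in> states G" "i < k"
  then show "\<rho> s i \<le> max_reward G k \<rho>"
    unfolding max_reward_def by (intro Max_ge finite_rewards) auto
qed (use wg in simp_all)

sublocale safety_monitor_for G "{..<N}" upd init_mem safe "window_stability G k W D \<rho> \<mu> \<nu>"
proof
  fix w :: "nat \<Rightarrow> 's"
  show "w \<in> window_stability G k W D \<rho> \<mu> \<nu> \<longleftrightarrow>
      run G w \<and> (\<forall>t. safe (w t) (fold upd (map w [0..<t]) init_mem))"
  proof (cases "run G w")
    case True
    then have "w t \<in> states G" for t using wg(1) by (auto simp: run_def game_def)
    then interpret monitored_run "states G" k W D "max_reward G k \<rho>" \<rho> \<mu> \<nu> w
      by unfold_locales
    show ?thesis using True safe_iff by (simp add: window_stability_def mem_def)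
  qed (simp add: window_stability_def)
qed (use wg upd_less init_mem_less in auto)

end

locale presented_game = window_game +
  fixes ss :: "'a list" and es :: "(nat \<times> nat) list"
  assumes pres: "presents G ss es"
begin

abbreviation nS :: nat where "nS \<equiv> length ss"
abbreviation nE :: nat where "nE \<equiv> length es"

lemma ss_states: "i < nS \<Longrightarrow> ss ! i \<in> states G"
  using pres by (auto simp: presents_def)

lemma es_less: "e < nE \<Longrightarrow> fst (es ! e) < nS \<and> snd (es ! e) < nS"
  and es_edge: "e < nE \<Longrightarrow> (ss ! fst (es ! e), ss ! snd (es ! e)) \<in> edges G"
proof -
  assume "e < nE"
  then have "es ! e \<in> set es" by simp
  then have "es ! e \<in> {(i, j). i < nS \<and> j < nS \<and> (ss ! i, ss ! j) \<in> edges G}"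
    using pres by (simp add: presents_def)
  then show "fst (es ! e) < nS \<and> snd (es ! e) < nS" "(ss ! fst (es ! e), ss ! snd (es ! e)) \<in> edges G"
    by auto
qed

lemma edge_index:
  assumes "i < nS" "(ss ! i, s') \<in> edges G"
  obtains e where "e < nE" "fst (es ! e) = i" "ss ! snd (es ! e) = s'"
proof -
  have "s' \<in> set ss" using assms(2) wg(1) pres by (auto simp: game_def presents_def)
  then obtain j where j: "j < nS" "ss ! j = s'" by (auto simp: in_set_conv_nth)
  then have "(i, j) \<in> set es" using pres assms by (simp add: presents_def)
  then obtain e where "e < nE" "es ! e = (i, j)" by (auto simp: in_set_conv_nth)
  then show ?thesis using that j by simp
qed

text \<open>The facts about the input that must survive the whole program, which writes to none of
  these variables and arrays.\<close>

definition inp :: "store \<Rightarrow> bool" where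
  "inp s \<longleftrightarrow> vars s ''states'' = int nS \<and> vars s ''edges'' = int nE \<and> vars s ''k'' = int k \<and>
     vars s ''W'' = int W \<and> vars s ''D'' = int D \<and>
     (\<forall>i<nS. arrs s ''box'' (int i) = of_bool (ss ! i \<in> box G)) \<and>
     (\<forall>e<nE. arrs s ''src'' (int e) = int (fst (es ! e)) \<and> arrs s ''dst'' (int e) = int (snd (es ! e))) \<and>
     (\<forall>i<nS. \<forall>d<k. arrs s ''reward'' (int i * int k + int d) = int (\<rho> (ss ! i) d)) \<and>
     (\<forall>d<k. arrs s ''mu_num'' (int d) = fst (quotient_of (\<mu> d)) \<and>
            arrs s ''mu_den'' (int d) = snd (quotient_of (\<mu> d)) \<and>
            arrs s ''nu_num'' (int d) = fst (quotient_of (\<nu> d)) \<and>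
            arrs s ''nu_den'' (int d) = snd (quotient_of (\<nu> d)))"

lemma inp_setv [simp]:
  "x \<notin> {''states'', ''edges'', ''k'', ''W'', ''D''} \<Longrightarrow> inp (setv x v s) = inp s"
  by (simp add: inp_def)

lemma inp_seta [simp]:
  "a \<notin> {''box'', ''src'', ''dst'', ''reward'', ''mu_num'', ''mu_den'', ''nu_num'', ''nu_den''} \<Longrightarrow>
   inp (seta a i v s) = inp s"
  by (simp add: inp_def)

lemma inp_vars:
  assumes "inp s"
  shows "vars s ''W'' = int W" "vars s ''D'' = int D" "vars s ''k'' = int k"
    "vars s ''states'' = int nS" "vars s ''edges'' = int nE"
  using assms by (simp_all add: inp_def)

lemma inp_input_store: "inp (input_store G ss es k W D \<rho> \<mu> \<nu>)"
proof -
  have "array_of (map (\<lambda>a. int (\<rho> (ss ! (a div k)) (a mod k))) [0..<nS * k]) (int i * int k + int d) =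
      int (\<rho> (ss ! i) d)" if "i < nS" "d < k" for i d
    using array_of_nth[of "i * k + d" "map (\<lambda>a. int (\<rho> (ss ! (a div k)) (a mod k))) [0..<nS * k]"]
      index_less[OF that] that by simp
  then show ?thesis by (simp add: inp_def input_store_def array_of_nth)
qed

lemma expr_cost_not [simp]: "expr_cost (not_expr e) = 2 + expr_cost e"
  and eval_not [simp]: "eval_expr (not_expr e) s = 1 - eval_expr e s"
  by (simp_all add: not_expr_def)

lemma eval_max_one [simp]: "eval_expr (max_one_expr e) s = max 1 (eval_expr e s)"
  and expr_cost_max_one [simp]: "expr_cost (max_one_expr e) = 7 + 2 * expr_cost e"
  by (simp_all add: max_one_expr_def max_def)

definition nth_reward :: "nat \<Rightarrow> nat" where
  "nth_reward a = \<rho> (ss ! (a div k)) (a mod k)"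

lemma inp_reward: "inp s \<Longrightarrow> a < nS * k \<Longrightarrow> arrs s ''reward'' (int a) = int (nth_reward a)"
proof -
  assume "inp s" "a < nS * k"
  then have "arrs s ''reward'' (int (a div k) * int k + int (a mod k)) = int (nth_reward a)"
    using k div_less_of_less_mult[of a nS k] by (simp add: inp_def nth_reward_def)
  moreover have "int (a div k) * int k + int (a mod k) = int a"
    by (metis div_mult_mod_eq of_nat_add of_nat_mult)
  ultimately show ?thesis by simp
qed

definition reward_max :: "nat \<Rightarrow> nat" where
  "reward_max a = Max (insert 0 (nth_reward ` {..<a}))"

lemma reward_max_simps [simp]:
  "reward_max 0 = 0" "reward_max (Suc a) = max (nth_reward a) (reward_max a)"
proof -
  have "insert 0 (nth_reward ` {..<Suc a}) = insert (nth_reward a) (insert 0 (nth_reward ` {..<a}))"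
    by (auto simp: lessThan_Suc)
  then show "reward_max (Suc a) = max (nth_reward a) (reward_max a)"
    unfolding reward_max_def by (simp only:) (rule Max_insert, simp_all)
qed (simp add: reward_max_def)

lemma max_reward_eq: "max_reward G k \<rho> = reward_max (nS * k)"
proof -
  have "{\<rho> s i | s i. s \<in> states G \<and> i < k} = nth_reward ` {..<nS * k}" (is "?A = ?B")
  proof
    show "?A \<subseteq> ?B"
    proof
      fix r assume "r \<in> ?A"
      then obtain s d where sd: "r = \<rho> s d" "s \<in> states G" "d < k" by auto
      then obtain i where i: "i < nS" "ss ! i = s"
        using pres by (metis presents_def in_set_conv_nth)
      have "r = nth_reward (i * k + d)" using sd i by (simp add: nth_reward_def)
      then show "r \<in> ?B" using index_less[OF i(1) sd(3)] by simp
    qed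
    show "?B \<subseteq> ?A"
    proof
      fix r assume "r \<in> ?B"
      then obtain a where a: "r = \<rho> (ss ! (a div k)) (a mod k)" "a < nS * k"
        by (auto simp: nth_reward_def)
      moreover have "ss ! (a div k) \<in> states G" "a mod k < k"
        using k ss_states[OF div_less_of_less_mult[OF a(2)]] by simp_all
      ultimately show "r \<in> ?A" by blast
    qed
  qed
  \<comment> \<open>Over a non-empty range the inserted 0, the program's initial \<open>M\<close>,
    does not change a maximum of naturals.\<close>
  moreover have "nS * k \<noteq> 0"
    using k pres wg(1) by (auto simp: presents_def game_def)
  then have "nth_reward ` {..<nS * k} \<noteq> {}" by (simp only: image_is_empty lessThan_empty_iff) simp
  then have "Max (insert 0 (nth_reward ` {..<nS * k})) = Max (nth_reward ` {..<nS * k})"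
    by (subst Max_insert) simp_all
  ultimately show ?thesis
    unfolding max_reward_def reward_max_def by simp
qed

lemma reward_prog:
  assumes "inp s"
  shows "runs reward_prog (20 + nS * k * 30) s
    (\<lambda>s. inp s \<and> vars s ''M'' = int (max_reward G k \<rho>))"
proof -
  let ?I = "\<lambda>a s. inp s \<and> vars s ''SK'' = int nS * int k \<and>
    vars s ''M'' = int (reward_max a)"
  have body: "runs (''M'' ::= Var ''M'' [+] (Var ''M'' [<] Arr ''reward'' (Var ''a'')) [*]
          (Arr ''reward'' (Var ''a'') [-] Var ''M'')) 22 s (\<lambda>s. ?I (Suc a) s \<and> vars s ''a'' = int a)"
    if "a < nS * k" "?I a s" "vars s ''a'' = int a" for a s
  proof -
    show ?thesis
      using that inp_reward[of s a]
      by (intro runs_le[OF runs_assign[where Q = "\<lambda>s. ?I (Suc a) s \<and> vars s ''a'' = int a"]])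
        (simp_all add: max_def)
  qed
  show ?thesis
    unfolding reward_prog_def
    by (rule runs_le, rule runs_assign_seq, rule runs_assign_seq,
        rule runs_for[where I = ?I and n = "nS * k", OF _ _ _ body])
      (use assms in \<open>simp_all add: max_reward_eq inp_vars\<close>)
qed

section \<open>Parameters and powers of the base\<close>

definition params :: "store \<Rightarrow> bool" where
  "params s \<longleftrightarrow> inp s \<and> vars s ''B'' = int B \<and> vars s ''F'' = int F \<and> vars s ''K'' = int K \<and>
     vars s ''N'' = int N \<and> vars s ''SN'' = int nS * int N \<and> vars s ''EN'' = int nE * int N \<and>
     vars s ''I'' = int init_mem \<and> (\<forall>j<K. arrs s ''pow'' (int j) = int B ^ j)"

lemma params_setv [simp]:
  "x \<notin> {''states'', ''edges'', ''k'', ''W'', ''D'', ''B'', ''F'', ''K'', ''N'', ''SN'', ''EN'', ''I''} \<Longrightarrow>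
   params (setv x v s) = params s"
  by (simp add: params_def)

lemma params_seta [simp]:
  "a \<notin> {''box'', ''src'', ''dst'', ''reward'', ''mu_num'', ''mu_den'', ''nu_num'', ''nu_den'', ''pow''} \<Longrightarrow>
   params (seta a i v s) = params s"
  by (simp add: params_def)

lemma power_prog:
  assumes "inp s" "vars s ''M'' = int (max_reward G k \<rho>)"
  shows "runs power_prog (100 + K * 30) s params"
proof -
  let ?I = "\<lambda>j s. inp s \<and> vars s ''B'' = int B \<and> vars s ''F'' = int F \<and> vars s ''K'' = int K \<and>
    vars s ''P'' = int B ^ j \<and> (\<forall>j'<j. arrs s ''pow'' (int j') = int B ^ j')"
  have body: "runs (Store ''pow'' (Var ''j'') (Var ''P'') ;; ''P'' ::= Var ''P'' [*] Var ''B'') 22 s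
      (\<lambda>s. ?I (Suc j) s \<and> vars s ''j'' = int j)"
    if "j < K" "?I j s" "vars s ''j'' = int j" for j s
    by (rule runs_le, rule runs_store_seq, rule runs_assign) (use that in \<open>simp_all add: less_Suc_eq\<close>)
  have "runs (for_loop ''j'' ''K'' (Store ''pow'' (Var ''j'') (Var ''P'') ;; ''P'' ::= Var ''P'' [*] Var ''B'') ;;
     ''N'' ::= Var ''W'' [*] Var ''P'' ;;
     ''SN'' ::= Var ''states'' [*] Var ''N'' ;;
     ''EN'' ::= Var ''edges'' [*] Var ''N'' ;;
     ''I'' ::= Var ''W'' [*] (Var ''F'' [mod] Var ''B'')) (40 + K * 30) s params"
    if s: "?I 0 s" for s
  proof (rule runs_le, rule runs_seq)
    show "runs (for_loop ''j'' ''K'' (Store ''pow'' (Var ''j'') (Var ''P'') ;; ''P'' ::= Var ''P'' [*] Var ''B''))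
      (6 + K * (22 + 8)) s (?I K)"
      by (rule runs_for[where I = ?I, OF s _ _ body]) simp_all
    fix s assume s: "?I K s"
    then show "runs (''N'' ::= Var ''W'' [*] Var ''P'' ;;
     ''SN'' ::= Var ''states'' [*] Var ''N'' ;;
     ''EN'' ::= Var ''edges'' [*] Var ''N'' ;;
     ''I'' ::= Var ''W'' [*] (Var ''F'' [mod] Var ''B'')) 30 s params"
      by (intro runs_le[OF runs_assign_seq[OF runs_assign_seq[OF runs_assign_seq[OF runs_assign]]]])
        (simp_all add: params_def inp_vars N_def init_mem_def zmod_int)
  qed simp
  note loop = this
  show ?thesis
    unfolding power_prog_def
    by (rule runs_le, rule runs_assign_seq, rule runs_assign_seq, rule runs_assign_seq,
        rule runs_assign_seq, rule loop)
      (use assms in \<open>simp_all add: inp_vars B_def F_def K_def zdiv_int of_nat_max\<close>)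
qed

lemma in_bounds_iff:
  "in_bounds i x \<longleftrightarrow> \<not> int x * snd (quotient_of (\<mu> i)) < int W * fst (quotient_of (\<mu> i)) \<and>
     \<not> int W * fst (quotient_of (\<nu> i)) < int x * snd (quotient_of (\<nu> i))"
  using rat_le_quotient_of_iff(1)[of "int x" "int W" "\<nu> i"]
    rat_le_quotient_of_iff(2)[of "int W" "\<mu> i" "int x"]
  by (simp add: in_bounds_def)

lemma params_vars:
  assumes "params s"
  shows "vars s ''W'' = int W" "vars s ''D'' = int D" "vars s ''k'' = int k"
    "vars s ''states'' = int nS" "vars s ''edges'' = int nE"
    "vars s ''B'' = int B" "vars s ''F'' = int F" "vars s ''K'' = int K" "vars s ''N'' = int N"
    "vars s ''SN'' = int nS * int N" "vars s ''EN'' = int nE * int N" "vars s ''I'' = int init_mem"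
    "j < K \<Longrightarrow> arrs s ''pow'' (int j) = int B ^ j"
  using assms by (simp_all add: params_def inp_vars)

lemma params_arrs:
  assumes "params s"
  shows "i < nS \<Longrightarrow> arrs s ''box'' (int i) = of_bool (ss ! i \<in> box G)"
    "e < nE \<Longrightarrow> arrs s ''src'' (int e) = int (fst (es ! e))"
    "e < nE \<Longrightarrow> arrs s ''dst'' (int e) = int (snd (es ! e))"
    "i < nS \<Longrightarrow> d < k \<Longrightarrow> arrs s ''reward'' (int i * int k + int d) = int (\<rho> (ss ! i) d)"
    "d < k \<Longrightarrow> arrs s ''mu_num'' (int d) = fst (quotient_of (\<mu> d))"
    "d < k \<Longrightarrow> arrs s ''mu_den'' (int d) = snd (quotient_of (\<mu> d))"
    "d < k \<Longrightarrow> arrs s ''nu_num'' (int d) = fst (quotient_of (\<nu> d))"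
    "d < k \<Longrightarrow> arrs s ''nu_den'' (int d) = snd (quotient_of (\<nu> d))"
  using assms by (simp_all add: params_def inp_def)

section \<open>Tabulating the monitor\<close>

definition table :: "nat \<Rightarrow> store \<Rightarrow> bool" where
  "table x s \<longleftrightarrow> (\<forall>y<x. arrs s ''up'' (int y) = int (upd (ss ! (y div N)) (y mod N)) \<and>
     arrs s ''win'' (int y) = of_bool (safe (ss ! (y div N)) (y mod N)))"

lemma table_setv [simp]: "table x (setv y v s) = table x s"
  by (simp add: table_def)

definition row :: "nat \<Rightarrow> nat \<Rightarrow> store \<Rightarrow> bool" where
  "row x j s \<longleftrightarrow> (let m = x mod N; q = ss ! (x div N) in params s \<and> table x s \<and>
     vars s ''x'' = int x \<and> vars s ''v'' = int (m div W) \<and> vars s ''nxt'' = int (nxt m) \<and>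
     vars s ''cur'' = int (cur m) \<and> vars s ''cur2'' = int (cur (nxt m)) \<and>
     vars s ''su'' = of_bool (startup m) \<and>
     vars s ''acc'' = int (\<Sum>j'<j. new_digit q m j' * B ^ j') \<and>
     vars s ''ok'' = of_bool (startup m \<or>
       (\<forall>j'<j. nxt m = j' div k * D \<longrightarrow> in_bounds (j' mod k) (tot q m j'))))"

lemma digit_prog:
  assumes x: "x < nS * N" and j: "j < K" and row: "row x j s" and sj: "vars s ''j'' = int j"
  shows "runs digit_prog 200 s (\<lambda>s. row x (Suc j) s \<and> vars s ''j'' = int j)"
proof -
  define m i where "m = x mod N" and "i = x div N"
  let ?q = "ss ! i"
  have s: "params s" "table x s" "vars s ''x'' = int x" "vars s ''v'' = int (m div W)"
    "vars s ''nxt'' = int (nxt m)" "vars s ''cur'' = int (cur m)" "vars s ''cur2'' = int (cur (nxt m))"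
    "vars s ''su'' = of_bool (startup m)"
    "vars s ''acc'' = int (\<Sum>j'<j. new_digit ?q m j' * B ^ j')"
    "vars s ''ok'' = of_bool (startup m \<or>
       (\<forall>j'<j. nxt m = j' div k * D \<longrightarrow> in_bounds (j' mod k) (tot ?q m j')))"
    using row by (simp_all add: row_def Let_def m_def i_def)
  note p = params_vars[OF s(1)] params_arrs[OF s(1)]
  have i: "i < nS" using x by (simp add: i_def div_less_of_less_mult)
  have d: "j mod k < k" using k by simp
  have xi: "int x div int N = int i" by (simp add: i_def zdiv_int)
  show ?thesis
    unfolding digit_prog_def
    apply (rule runs_le)
     apply (rule runs_assign_seq_val[where v = "int (digit m j)"])
      apply (simp add: p s sj j digit_def zdiv_int zmod_int)
     apply (rule runs_assign_seq_val[where v = "int (if j = cur m then digit m j mod F else digit m j)"])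
      apply (simp add: p s sj zmod_int)
     apply (rule runs_assign_seq_val[where v = "int (j mod k)"])
      apply (simp add: p sj zmod_int)
     apply (rule runs_assign_seq_val[where v = "int (tot ?q m j)"])
      apply (simp add: p s xi i d tot_def)
     apply (rule runs_assign_seq_val[where v = "of_bool (nxt m = j div k * D)"])
      apply (simp add: p s sj zdiv_int[symmetric] flip: of_nat_mult)
     apply (rule runs_assign_seq_val[where v = "of_bool (\<not> in_bounds (j mod k) (tot ?q m j))"])
      apply (simp add: p d in_bounds_iff)
     apply (rule runs_assign_seq_val[where v = "of_bool (startup m \<or>
       (\<forall>j'<Suc j. nxt m = j' div k * D \<longrightarrow> in_bounds (j' mod k) (tot ?q m j')))"])
      apply (simp add: s less_Suc_eq)
      apply (cases "startup m"; cases "nxt m = j div k * D"; cases "in_bounds (j mod k) (tot ?q m j)"; auto)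
     apply (rule runs_assign_val[where v = "int (\<Sum>j'<Suc j. new_digit ?q m j' * B ^ j')"])
      apply (simp add: s p j sj new_digit_def zmod_int)
     apply (simp add: row_def Let_def s sj flip: m_def i_def)
    apply simp
    done
qed

lemma table_Suc_seta:
  assumes "table x s"
  shows "table (Suc x) (seta ''win'' (int x) (of_bool (safe (ss ! (x div N)) (x mod N)))
     (seta ''up'' (int x) (int (upd (ss ! (x div N)) (x mod N))) s))"
  using assms by (auto simp: table_def less_Suc_eq)

lemma row_prog:
  assumes x: "x < nS * N" and s: "params s" "table x s" "vars s ''x'' = int x"
  shows "runs row_prog (300 + K * 208) s (\<lambda>s. (params s \<and> table (Suc x) s) \<and> vars s ''x'' = int x)"
proof -
  define m i where "m = x mod N" and "i = x div N"
  let ?q = "ss ! i"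
  note p = params_vars[OF s(1)]
  have "nxt m < W" by (rule nxt_less)
  have loop: "runs (for_loop ''j'' ''K'' digit_prog ;;
     Store ''up'' (Var ''x'') (Var ''nxt'' [+] Var ''W'' [*] Var ''acc'') ;;
     Store ''win'' (Var ''x'') (Var ''ok'')) (6 + K * (200 + 8) + 20) s
     (\<lambda>s. (params s \<and> table (Suc x) s) \<and> vars s ''x'' = int x)" if "row x 0 s" for s
  proof (rule runs_seq)
    show "runs (for_loop ''j'' ''K'' digit_prog) (6 + K * (200 + 8)) s (row x K)"
      by (rule runs_for[where I = "row x", OF that _ _ digit_prog])
        (simp_all add: x row_def Let_def params_vars)
    fix s assume "row x K s"
    then have r: "params s" "table x s" "vars s ''x'' = int x" "vars s ''nxt'' = int (nxt m)"
      "vars s ''acc'' = int (\<Sum>j'<K. new_digit ?q m j' * B ^ j')"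
      "vars s ''ok'' = of_bool (safe ?q m)"
      by (simp_all add: row_def Let_def m_def i_def safe_def)
    show "runs (Store ''up'' (Var ''x'') (Var ''nxt'' [+] Var ''W'' [*] Var ''acc'') ;;
     Store ''win'' (Var ''x'') (Var ''ok'')) 20 s
     (\<lambda>s. (params s \<and> table (Suc x) s) \<and> vars s ''x'' = int x)"
      apply (rule runs_le)
       apply (rule runs_store_seq_val[where iv = "int x" and v = "int (upd ?q m)"])
         apply (simp add: r)
        apply (simp add: r params_vars upd_def)
       apply (rule runs_store_val[where iv = "int x" and v = "of_bool (safe ?q m)"])
         apply (simp add: r)
        apply (simp add: r)
       apply (use table_Suc_seta[OF r(2)] r in \<open>simp add: m_def i_def\<close>)
      apply simp
      done
  qed
  show ?thesis
    unfolding row_prog_def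
    apply (rule runs_le)
     apply (rule runs_assign_seq_val[where v = "int m"])
      apply (simp add: s p m_def zmod_int)
     apply (rule runs_assign_seq_val[where v = "int (m div W)"])
      apply (simp add: p zdiv_int)
     apply (rule runs_assign_seq_val[where v = "int (nxt m)"])
      apply (simp add: p nxt_def zmod_int add.commute)
     apply (rule runs_assign_seq_val[where v = "int (cur m)"])
      apply (simp add: p cur_def zdiv_int zmod_int)
     \<comment> \<open>\<open>cur\<close> reduces modulo \<open>W\<close> and the program does not;
       \<open>nxt m < W\<close> makes the values equal.\<close>
     apply (rule runs_assign_seq_val[where v = "int (cur (nxt m))"])
      apply (simp add: p cur_def \<open>nxt m < W\<close> zdiv_int)
     apply (rule runs_assign_seq_val[where v = "of_bool (startup m)"])
      apply (simp add: p cur_less startup_def digit_def not_less flip: of_nat_power zdiv_int zmod_int)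
      apply (auto simp: not_less)[1]
     apply (rule runs_assign_seq_val[where v = 0], simp)
     apply (rule runs_assign_seq_val[where v = 1], simp)
     apply (rule loop)
     apply (simp add: row_def Let_def s flip: m_def)
    apply simp
    done
qed

section \<open>Refinement rounds on product indices\<close>

definition pair :: "nat \<Rightarrow> 'a \<times> nat" where
  "pair x = (ss ! (x div N), x mod N)"

definition tables :: "('a \<times> nat) set \<Rightarrow> store \<Rightarrow> bool" where
  "tables X s \<longleftrightarrow> params s \<and>
     (\<forall>x<nS * N. arrs s ''up'' (int x) = int (upd (ss ! (x div N)) (x mod N)) \<and>
                 arrs s ''win'' (int x) = of_bool (pair x \<in> X))"

lemma pair_safe: "x < nS * N \<Longrightarrow> pair x \<in> safe_pairs \<longleftrightarrow> safe (ss ! (x div N)) (x mod N)"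
  using N_pos ss_states[OF div_less_of_less_mult] by (simp add: pair_def safe_pairs_def)

lemma rows_prog:
  assumes "params s"
  shows "runs (for_loop ''x'' ''SN'' row_prog) (6 + nS * N * (300 + K * 208 + 8)) s (tables safe_pairs)"
proof (rule runs_for[where I = "\<lambda>x s. params s \<and> table x s"])
  fix x s assume "x < nS * N" "params s \<and> table x s" "vars s ''x'' = int x"
  then show "runs row_prog (300 + K * 208) s (\<lambda>s. (params s \<and> table (Suc x) s) \<and> vars s ''x'' = int x)"
    by (intro row_prog) simp_all
qed (use assms in \<open>auto simp: table_def params_vars tables_def pair_safe\<close>)

definition source :: "nat \<Rightarrow> nat" where
  "source a = fst (es ! (a div N)) * N + a mod N"

definition target :: "nat \<Rightarrow> nat" where
  "target a = snd (es ! (a div N)) * N + upd (ss ! fst (es ! (a div N))) (a mod N)"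

lemma edge_indices:
  assumes "a < nE * N"
  shows "source a < nS * N" "target a < nS * N"
    "source a div N = fst (es ! (a div N))" "source a mod N = a mod N"
    "pair (target a) = (ss ! snd (es ! (a div N)), upd (ss ! fst (es ! (a div N))) (a mod N))"
proof -
  have "a div N < nE" using assms by (rule div_less_of_less_mult)
  then show "source a < nS * N" "target a < nS * N"
    unfolding source_def target_def using es_less N_pos upd_less by (auto intro!: index_less)
qed (use N_pos upd_less in \<open>simp_all add: source_def target_def pair_def\<close>)

text \<open>Product edges out of \<open>x\<close> are copies of the edges of \<open>G\<close> out of
  its state, all with the same updated memory. \<open>P\<close> stays abstract: membership gives the
  box case, non-membership the universal case by negation.\<close>

lemma ex_edge_iff:
  assumes "x < nS * N"
  shows "(\<exists>a<nE * N. source a = x \<and> P (pair (target a))) \<longleftrightarrow>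
    (\<exists>s'. (fst (pair x), s') \<in> edges G \<and> P (s', upd (fst (pair x)) (snd (pair x))))"
proof
  assume "\<exists>a<nE * N. source a = x \<and> P (pair (target a))"
  then obtain a where a: "a < nE * N" "source a = x" "P (pair (target a))" by blast
  then show "\<exists>s'. (fst (pair x), s') \<in> edges G \<and> P (s', upd (fst (pair x)) (snd (pair x)))"
    using edge_indices[OF a(1)] es_edge[OF div_less_of_less_mult[OF a(1)]] by (auto simp: pair_def)
next
  assume "\<exists>s'. (fst (pair x), s') \<in> edges G \<and> P (s', upd (fst (pair x)) (snd (pair x)))"
  then obtain s' where s': "(ss ! (x div N), s') \<in> edges G" "P (s', upd (ss ! (x div N)) (x mod N))"
    by (auto simp: pair_def)
  obtain e where e: "e < nE" "fst (es ! e) = x div N" "ss ! snd (es ! e) = s'"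
    using edge_index[OF div_less_of_less_mult[OF assms] s'(1)] .
  let ?a = "e * N + x mod N"
  have "?a < nE * N" using e(1) N_pos by (auto intro: index_less)
  moreover have "source ?a = x" using e N_pos by (simp add: source_def)
  moreover have "P (pair (target ?a))"
    using edge_indices(5)[OF \<open>?a < nE * N\<close>] e s' N_pos by simp
  ultimately show "\<exists>a<nE * N. source a = x \<and> P (pair (target a))" by blast
qed

text \<open>The condition imposed by \<open>refine\<close> on a pair, restricted to the first \<open>a\<close> edges of the product.\<close>

definition good :: "('a \<times> nat) set \<Rightarrow> nat \<Rightarrow> nat \<Rightarrow> bool" where
  "good X a x \<longleftrightarrow> (if fst (pair x) \<in> box G then \<exists>a'<a. source a' = x \<and> pair (target a') \<in> X
                 else \<forall>a'<a. source a' = x \<longrightarrow> pair (target a') \<in> X)"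

lemma good_Suc:
  "good X (Suc a) x \<longleftrightarrow> (if source a \<noteq> x then good X a x
     else if fst (pair x) \<in> box G then good X a x \<or> pair (target a) \<in> X
     else good X a x \<and> pair (target a) \<in> X)"
  by (auto simp: good_def less_Suc_eq)

lemma refine_iff_good:
  "x < nS * N \<Longrightarrow> pair x \<in> refine X \<longleftrightarrow> pair x \<in> X \<and> good X (nE * N) x"
  using ex_edge_iff[of x "\<lambda>p. p \<in> X"] ex_edge_iff[of x "\<lambda>p. p \<notin> X"]
  by (auto simp: refine_def good_def split: prod.splits)

lemma tables_setv [simp]:
  "x \<notin> {''states'', ''edges'', ''k'', ''W'', ''D'', ''B'', ''F'', ''K'', ''N'', ''SN'', ''EN'', ''I''} \<Longrightarrow>
   tables X (setv x v s) = tables X s"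
  by (simp add: tables_def)

lemma tables_seta [simp]: "a \<in> {''new'', ''const'', ''init''} \<Longrightarrow> tables X (seta a i v s) = tables X s"
  by (auto simp: tables_def)

lemma tables_vars:
  assumes "tables X s"
  shows "params s" "x < nS * N \<Longrightarrow> arrs s ''up'' (int x) = int (upd (ss ! (x div N)) (x mod N))"
    "x < nS * N \<Longrightarrow> arrs s ''win'' (int x) = of_bool (pair x \<in> X)"
  using assms by (simp_all add: tables_def)

lemma source_target_eval:
  assumes "tables X s" "vars s ''a'' = int a" "a < nE * N"
  shows "arrs s ''src'' (int a div int N) = int (fst (es ! (a div N)))"
    "eval_expr source_expr s = int (source a)" "eval_expr target_expr s = int (target a)"
proof -
  note p = params_vars[OF tables_vars(1)[OF assms(1)]] params_arrs[OF tables_vars(1)[OF assms(1)]]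
  have a: "a div N < nE" using assms(3) by (rule div_less_of_less_mult)
  show src: "arrs s ''src'' (int a div int N) = int (fst (es ! (a div N)))"
    using p(15)[OF a] by (simp add: zdiv_int)
  have dst: "arrs s ''dst'' (int a div int N) = int (snd (es ! (a div N)))"
    using p(16)[OF a] by (simp add: zdiv_int)
  show source: "eval_expr source_expr s = int (source a)"
    by (simp add: source_expr_def source_def p assms(2) src zmod_int)
  show "eval_expr target_expr s = int (target a)"
    using tables_vars(2)[OF assms(1) edge_indices(1)[OF assms(3)]] edge_indices(3,4)[OF assms(3)]
    by (simp add: target_expr_def source target_def p assms(2) dst)
qed

lemma expr_cost_source [simp]: "expr_cost source_expr = 10"
  and expr_cost_target [simp]: "expr_cost target_expr = 18"
  by (simp_all add: source_expr_def target_expr_def)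

lemma edge_prog:
  assumes a: "a < nE * N" and s: "tables X s" "vars s ''a'' = int a" and r: "vars s ''r'' = r"
    and new: "\<forall>x<nS * N. arrs s ''new'' (int x) = of_bool (good X a x)"
  shows "runs edge_prog 150 s (\<lambda>s. (tables X s \<and> vars s ''r'' = r \<and>
    (\<forall>x<nS * N. arrs s ''new'' (int x) = of_bool (good X (Suc a) x))) \<and> vars s ''a'' = int a)"
proof -
  note p = params_vars[OF tables_vars(1)[OF s(1)]] params_arrs[OF tables_vars(1)[OF s(1)]]
  let ?x = "source a" and ?i = "fst (es ! (a div N))"
  note idx = edge_indices[OF a]
  have i: "?i < nS" using es_less[OF div_less_of_less_mult[OF a]] by simp
  have px: "fst (pair ?x) = ss ! ?i" using idx(3) by (simp add: pair_def)
  have eval: "eval_expr target_expr (setv ''y'' v s) = int (target a)" for v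
    using s a source_target_eval(3)[of X "setv ''y'' v s" a] by simp
  show ?thesis
    unfolding edge_prog_def
    apply (rule runs_le)
     apply (rule runs_assign_seq_val[where v = "int ?x"])
      apply (rule source_target_eval(2)[OF s a])
     apply (rule runs_assign_seq_val[where v = "of_bool (pair (target a) \<in> X)"])
      apply (simp add: eval tables_vars(3)[OF s(1) idx(2)])
     apply (rule runs_assign_seq_val[where v = "of_bool (ss ! ?i \<in> box G)"])
      apply (simp add: p s source_target_eval(1)[OF s a] i)
     apply (rule runs_store_val[where iv = "int ?x" and v = "of_bool (good X (Suc a) ?x)"])
       apply simp
      apply (simp add: new idx(1) good_Suc px)
     apply (use s new r in \<open>auto simp: good_Suc\<close>)[1]
    apply simp
    done
qed

lemma refine_prog:
  assumes "tables X s" "vars s ''r'' = r"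
  shows "runs refine_prog (30 + nS * N * 50 + nE * N * 158) s
    (\<lambda>s. tables (refine X) s \<and> vars s ''r'' = r)"
proof -
  let ?I1 = "\<lambda>x s. tables X s \<and> vars s ''r'' = r \<and> (\<forall>y<x. arrs s ''new'' (int y) = of_bool (ss ! (y div N) \<notin> box G))"
  let ?I2 = "\<lambda>a s. tables X s \<and> vars s ''r'' = r \<and> (\<forall>x<nS * N. arrs s ''new'' (int x) = of_bool (good X a x))"
  \<comment> \<open>While \<open>win\<close> is being overwritten, entries below \<open>x\<close>
    hold the new set and the others the old one. \<open>r\<close> is carried along for the enclosing
    loop.\<close>
  let ?I3 = "\<lambda>x s. params s \<and> vars s ''r'' = r \<and> (\<forall>y<nS * N. arrs s ''new'' (int y) = of_bool (good X (nE * N) y) \<and>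
     arrs s ''up'' (int y) = int (upd (ss ! (y div N)) (y mod N)) \<and>
     arrs s ''win'' (int y) = of_bool (if y < x then pair y \<in> refine X else pair y \<in> X))"
  have 1: "runs (for_loop ''x'' ''SN'' (Store ''new'' (Var ''x'') (not_expr (Arr ''box'' (Var ''x'' [div] Var ''N'')))))
      (6 + nS * N * (10 + 8)) s (?I2 0)"
  proof (rule runs_for[where I = ?I1])
    fix x s assume x: "x < nS * N" and I: "?I1 x s" and v: "vars s ''x'' = int x"
    have "arrs s ''box'' (int x div int N) = of_bool (ss ! (x div N) \<in> box G)"
      using params_arrs(1)[OF tables_vars(1)[of X s], of "x div N"] I div_less_of_less_mult[OF x]
      by (simp add: zdiv_int)
    then show "runs (Store ''new'' (Var ''x'') (not_expr (Arr ''box'' (Var ''x'' [div] Var ''N'')))) 10 s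
        (\<lambda>s. ?I1 (Suc x) s \<and> vars s ''x'' = int x)"
      using I v params_vars(9)[OF tables_vars(1)[of X s]]
      by (intro runs_le[OF runs_store]) (auto simp: less_Suc_eq)
  qed (use assms in \<open>auto simp: params_vars tables_vars(1) good_def pair_def\<close>)
  have 2: "runs (for_loop ''a'' ''EN'' edge_prog) (6 + nE * N * (150 + 8)) s (?I3 0)" if "?I2 0 s" for s
  proof (rule runs_for[where I = ?I2])
    fix a s assume "a < nE * N" "?I2 a s" "vars s ''a'' = int a"
    then show "runs edge_prog 150 s (\<lambda>s. ?I2 (Suc a) s \<and> vars s ''a'' = int a)"
      by (intro edge_prog) simp_all
  qed (use that in \<open>auto simp: params_vars tables_vars\<close>)
  have 3: "runs (for_loop ''x'' ''SN'' (Store ''win'' (Var ''x'') (Arr ''win'' (Var ''x'') [*] Arr ''new'' (Var ''x''))))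
      (6 + nS * N * (10 + 8)) s (\<lambda>s. tables (refine X) s \<and> vars s ''r'' = r)" if "?I3 0 s" for s
  proof (rule runs_for[where I = ?I3])
    fix x s assume x: "x < nS * N" and I: "?I3 x s" and v: "vars s ''x'' = int x"
    have win: "arrs s ''win'' (int x) = of_bool (pair x \<in> X)" and new: "arrs s ''new'' (int x) = of_bool (good X (nE * N) x)"
      using I x by auto
    show "runs (Store ''win'' (Var ''x'') (Arr ''win'' (Var ''x'') [*] Arr ''new'' (Var ''x''))) 10 s
        (\<lambda>s. ?I3 (Suc x) s \<and> vars s ''x'' = int x)"
      apply (rule runs_le)
       apply (rule runs_store_val[where iv = "int x" and v = "of_bool (pair x \<in> refine X)"])
         apply (simp add: v)
        apply (simp add: v win new refine_iff_good[OF x])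
       apply (use I v in \<open>auto simp: less_Suc_eq\<close>)[1]
      apply simp
      done
  qed (use that in \<open>auto simp: params_vars tables_def\<close>)
  show ?thesis
    unfolding refine_prog_def
    by (rule runs_le, rule runs_seq[OF 1], rule runs_seq[OF 2], assumption, rule 3)
      (simp_all add: algebra_simps)
qed

lemma rounds_prog:
  assumes "tables safe_pairs s"
  shows "runs (for_loop ''r'' ''SN'' refine_prog)
    (6 + nS * N * (30 + nS * N * 50 + nE * N * 158 + 8)) s (tables win)"
proof -
  have "card (states G) = nS"
    using pres by (metis presents_def distinct_card)
  then have win: "(refine ^^ (nS * N)) safe_pairs = win" by (simp add: win_def)
  show ?thesis
  proof (rule runs_for[where I = "\<lambda>r. tables ((refine ^^ r) safe_pairs)"])
    fix r s assume "tables ((refine ^^ r) safe_pairs) s" "vars s ''r'' = int r"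
    then show "runs refine_prog (30 + nS * N * 50 + nE * N * 158) s
       (\<lambda>s. tables ((refine ^^ Suc r) safe_pairs) s \<and> vars s ''r'' = int r)"
      using refine_prog by simp
  qed (use assms in \<open>simp_all add: win params_vars tables_vars(1)\<close>)
qed


section \<open>Writing out the scheme\<close>

lemma outputs_prog:
  assumes "tables win s"
  shows "runs output_prog (30 + nE * N * 50 + nS * 50) s (output_scheme G ss es win_scheme)"
proof -
  let ?I1 = "\<lambda>a s. tables win s \<and>
    (\<forall>a'<a. arrs s ''const'' (int a') = of_bool (pair (target a') \<in> win))"
  let ?init = "\<lambda>i. if (ss ! i, init_mem) \<in> win then int init_mem else -1"
  let ?I2 = "\<lambda>i s. ?I1 (nE * N) s \<and> (\<forall>i'<i. arrs s ''init'' (int i') = ?init i')"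
  have 1: "runs (for_loop ''a'' ''EN'' (Store ''const'' (Var ''a'') (Arr ''win'' target_expr)))
      (6 + nE * N * (30 + 8)) s (?I2 0)"
  proof (rule runs_for[where I = ?I1])
    fix a s assume a: "a < nE * N" and I: "?I1 a s" and v: "vars s ''a'' = int a"
    then have t: "tables win s" by simp
    show "runs (Store ''const'' (Var ''a'') (Arr ''win'' target_expr)) 30 s
        (\<lambda>s. ?I1 (Suc a) s \<and> vars s ''a'' = int a)"
      apply (rule runs_le)
       apply (rule runs_store_val[where iv = "int a" and v = "of_bool (pair (target a) \<in> win)"])
         apply (simp add: v)
        apply (simp add: source_target_eval(3)[OF t v a] tables_vars(3)[OF t edge_indices(2)[OF a]])
       apply (use I v in \<open>auto simp: less_Suc_eq\<close>)[1]
      apply simp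
      done
  qed (use assms in \<open>auto simp: params_vars tables_vars(1)\<close>)
  have 2: "runs (for_loop ''i'' ''states'' (Store ''init'' (Var ''i'')
       (Arr ''win'' (Var ''i'' [*] Var ''N'' [+] Var ''I'') [*] (Var ''I'' [+] Num 1) [-] Num 1)))
      (6 + nS * (30 + 8)) s (?I2 nS)" if "?I2 0 s" for s
  proof (rule runs_for[where I = ?I2])
    fix i s assume i: "i < nS" and I: "?I2 i s" and v: "vars s ''i'' = int i"
    then have t: "tables win s" by simp
    have "pair (i * N + init_mem) = (ss ! i, init_mem)" using init_mem_less by (simp add: pair_def)
    then have w: "arrs s ''win'' (int i * int N + int init_mem) = of_bool ((ss ! i, init_mem) \<in> win)"
      using tables_vars(3)[OF t index_less[OF i init_mem_less]] by simp
    show "runs (Store ''init'' (Var ''i'')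
       (Arr ''win'' (Var ''i'' [*] Var ''N'' [+] Var ''I'') [*] (Var ''I'' [+] Num 1) [-] Num 1)) 30 s
        (\<lambda>s. ?I2 (Suc i) s \<and> vars s ''i'' = int i)"
      apply (rule runs_le)
       apply (rule runs_store_val[where iv = "int i" and v = "?init i"])
         apply (simp add: v)
        apply (simp add: v w params_vars[OF tables_vars(1)[OF t]])
       apply (use I v in \<open>auto simp: less_Suc_eq\<close>)[1]
      apply simp
      done
  qed (use that in \<open>auto simp: params_vars tables_vars(1)\<close>)
  have 3: "output_scheme G ss es win_scheme s" if s: "?I2 nS s" for s
  proof -
    have t: "tables win s" using s by simp
    have up: "arrs s ''up'' (int (i * N + m)) = int (upd (ss ! i) m)" if "i < nS" "m < N" for i m
      using tables_vars(2)[OF t index_less[OF that]] that by simp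
    have const: "arrs s ''const'' (int (j * N + m)) =
        of_bool (ss ! snd (es ! j) \<in> Const win_scheme (ss ! fst (es ! j)) m)" if "j < nE" "m < N" for j m
    proof -
      have "arrs s ''const'' (int (j * N + m)) = of_bool (pair (target (j * N + m)) \<in> win)"
        using s index_less[OF that] by blast
      then show ?thesis
        using edge_indices(5)[OF index_less[OF that]] that es_edge[OF that(1)]
        by (simp del: of_nat_add of_nat_mult)
    qed
    show ?thesis
      unfolding output_scheme_def
      by (rule exI[of _ N])
        (use s up const params_vars(9)[OF tables_vars(1)[OF t]] in auto)
  qed
  show ?thesis
    unfolding output_prog_def
    by (rule runs_le, rule runs_seq[OF 1], rule runs_mono[OF 2], assumption, rule order_refl, rule 3)
      (simp_all add: algebra_simps)
qed

text \<open>The budgets of the phases in order. The refinement dominates: \<open>nS * N\<close>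
  rounds, each over \<open>nS * N\<close> pairs and \<open>nE * N\<close> product edges.\<close>

definition time_bound :: nat where
  "time_bound = (20 + nS * k * 30) + ((100 + K * 30) + ((6 + nS * N * (300 + K * 208 + 8)) +
     ((6 + nS * N * (30 + nS * N * 50 + nE * N * 158 + 8)) + (30 + nE * N * 50 + nS * 50))))"

lemma window_prog:
  "runs window_prog time_bound (input_store G ss es k W D \<rho> \<mu> \<nu>) (output_scheme G ss es win_scheme)"
  unfolding window_prog_def time_bound_def
  by (intro runs_seq[OF reward_prog[OF inp_input_store]] runs_seq[OF power_prog] runs_seq[OF rows_prog]
      runs_seq[OF rounds_prog] outputs_prog) simp_all

text \<open>Up to constants each summand is \<open>a * b\<close> with \<open>a \<le> nS * nE\<close>
  and \<open>b \<le> R * R\<close>; \<open>nS \<le> nE\<close> because every state has an outgoing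
  edge. The base 2 yields \<open>K \<le> 2 ^ K \<le> R\<close>, which absorbs the factors
  \<open>k\<close> and \<open>K\<close>. The coefficients add up to less than 2000.\<close>

lemma time_bound_le:
  "time_bound \<le> 2000 * ((card (states G))\<^sup>2 * card (edges G) * W\<^sup>2 *
     max 2 (max_reward G k \<rho> * W) ^ (2 * k * (W div D)))"
proof -
  define R where "R = W * max 2 (max_reward G k \<rho> * W) ^ K"
  have nS: "card (states G) = nS" using pres by (metis presents_def distinct_card)
  have nE: "card (edges G) = nE"
  proof -
    have "inj_on (\<lambda>(i, j). (ss ! i, ss ! j)) (set es)"
      using pres by (auto simp: inj_on_def presents_def nth_eq_iff_index_eq)
    moreover have "(\<lambda>(i, j). (ss ! i, ss ! j)) ` set es = edges G"
    proof
      show "edges G \<subseteq> (\<lambda>(i, j). (ss ! i, ss ! j)) ` set es"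
      proof
        fix p assume p: "p \<in> edges G"
        then have "fst p \<in> set ss" using wg(1) pres by (auto simp: game_def presents_def)
        then obtain i where i: "i < nS" "ss ! i = fst p" by (auto simp: in_set_conv_nth)
        then obtain e where "e < nE" "fst (es ! e) = i" "ss ! snd (es ! e) = snd p"
          using edge_index[of i "snd p"] p by auto
        then have "p = (\<lambda>(i, j). (ss ! i, ss ! j)) (es ! e)" "es ! e \<in> set es"
          using i by (simp_all add: case_prod_beta)
        then show "p \<in> (\<lambda>(i, j). (ss ! i, ss ! j)) ` set es" by blast
      qed
    qed (use pres in \<open>auto simp: presents_def\<close>)
    ultimately show ?thesis using pres by (metis card_image distinct_card presents_def)
  qed
  have "card (states G) \<noteq> 0" using wg(1,2) by (simp add: game_def)
  then have S1: "1 \<le> nS" using nS by linarith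
  have SE: "nS \<le> nE"
  proof -
    have "states G \<subseteq> fst ` edges G"
    proof
      fix s assume "s \<in> states G"
      then have "(s, some_succ G s) \<in> edges G" by (rule some_succ[OF wg(1)])
      then show "s \<in> fst ` edges G" by (rule image_eqI[rotated]) simp
    qed
    moreover have "finite (edges G)"
      using wg(1,2) by (auto simp: game_def intro: finite_subset)
    ultimately have "card (states G) \<le> card (edges G)" by (meson surj_card_le)
    then show ?thesis using nS nE by simp
  qed
  have KR: "K \<le> R"
  proof -
    have "K \<le> 2 ^ K" by (simp add: less_imp_le)
    also have "\<dots> \<le> max 2 (max_reward G k \<rho> * W) ^ K" by (rule power_mono) simp_all
    also have "\<dots> \<le> R" using W by (simp add: R_def)
    finally show ?thesis .
  qed
  have kR: "k \<le> R"
  proof -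
    have "W div D \<noteq> 0" using K_pos by (auto simp: K_def)
    then have "k \<le> K" by (simp add: K_def)
    then show ?thesis using KR by simp
  qed
  have NR: "N \<le> R" unfolding N_def R_def B_def by (intro mult_le_mono2 power_mono) auto
  have R1: "1 \<le> R" using NR N_pos by simp
  define U where "U = nS * nS * nE * (R * R)"
  have mono: "a * b \<le> U" if "a \<le> nS * nE" "b \<le> R * R" for a b
  proof -
    have "nS * nE \<le> nS * nS * nE"
      using mult_le_mono1[OF S1, of "nS * nE"] by (simp only: mult_1 mult.assoc)
    then have "a \<le> nS * nS * nE" using that(1) by (rule le_trans[rotated])
    then show ?thesis unfolding U_def using that(2) by (rule mult_le_mono)
  qed
  have le: "nS \<le> nS * nE" "nE \<le> nS * nE" "nS * nS \<le> nS * nE" "1 \<le> nS * nE" "R \<le> R * R" "1 \<le> R * R"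
    using S1 SE R1 by simp_all
  have b: "1 \<le> U" "nS \<le> U" "nS * k \<le> U" "K \<le> U" "nS * N \<le> U" "nE * N \<le> U" "nS * (N * K) \<le> U"
    "nS * nS * (N * N) \<le> U" "nS * nE * (N * N) \<le> U"
  proof -
    show "1 \<le> U" using mono[of 1 1] le by simp
    show "nS \<le> U" using mono[of nS 1] le by simp
    show "nS * k \<le> U" using mono[of nS k] le kR by simp
    show "K \<le> U" using mono[of 1 K] le KR by simp
    show "nS * N \<le> U" using mono[of nS N] le NR by simp
    show "nE * N \<le> U" using mono[of nE N] le NR by simp
    show "nS * (N * K) \<le> U" using mono[of nS "N * K"] le NR KR by (simp add: mult_le_mono)
    show "nS * nS * (N * N) \<le> U" using mono[of "nS * nS" "N * N"] le NR by (simp add: mult_le_mono)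
    show "nS * nE * (N * N) \<le> U" using mono[of "nS * nE" "N * N"] le NR by (simp add: mult_le_mono)
  qed
  have "time_bound = 162 * 1 + nS * k * 30 + K * 30 + (nS * N) * 346 + (nS * (N * K)) * 208 +
      (nS * nS * (N * N)) * 50 + (nS * nE * (N * N)) * 158 + (nE * N) * 50 + nS * 50"
    unfolding time_bound_def by (simp add: algebra_simps)
  also have "\<dots> \<le> 2000 * U" using b by linarith
  also have "U = (card (states G))\<^sup>2 * card (edges G) * W\<^sup>2 *
     max 2 (max_reward G k \<rho> * W) ^ (2 * k * (W div D))"
    by (simp add: U_def R_def nS nE K_def power2_eq_square mult.assoc power_mult[symmetric] mult_ac
        power_add[symmetric] flip: mult_2)
  finally show ?thesis .
qed

end

theorem theorem1:
  "\<exists>(P :: prog) (C :: nat).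
     \<forall>(G :: 's game) (k :: nat) (W :: nat) (D :: nat) (\<rho> :: 's \<Rightarrow> nat \<Rightarrow> nat)
       (\<mu> :: nat \<Rightarrow> rat) (\<nu> :: nat \<Rightarrow> rat).
       game G \<and> finite (states G) \<and> 1 \<le> k \<and> 1 \<le> W \<and> 1 \<le> D \<and> D dvd W \<longrightarrow>
       (\<exists>\<Gamma> :: ('s, nat) scheme.
          strategy_scheme G \<Gamma> \<and>
          card (Mem \<Gamma>) = W * (max 1 (max_reward G k \<rho> * W)) ^ (k * (W div D)) \<and>
          permissive G \<Gamma> (window_stability G k W D \<rho> \<mu> \<nu>) \<and>
          (\<forall>ss es. presents G ss es \<longrightarrow>
            (\<exists>t s. exec P (input_store G ss es k W D \<rho> \<mu> \<nu>) t s \<and>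
               output_scheme G ss es \<Gamma> s \<and>
               t \<le> C * ((card (states G))\<^sup>2 * card (edges G) * W\<^sup>2 *
                         (max 2 (max_reward G k \<rho> * W)) ^ (2 * k * (W div D))))))"
proof (intro exI allI impI)
  fix G :: "'s game" and k W D :: nat and \<rho> :: "'s \<Rightarrow> nat \<Rightarrow> nat" and \<mu> \<nu> :: "nat \<Rightarrow> rat"
  assume "game G \<and> finite (states G) \<and> 1 \<le> k \<and> 1 \<le> W \<and> 1 \<le> D \<and> D dvd W"
  then interpret window_game G k W D \<rho> \<mu> \<nu> by unfold_locales simp_all
  \<comment> \<open>The witnesses \<open>window_prog\<close> and 2000 depend on neither game nor
    objective, and \<open>win_scheme\<close> does not depend on the enumerations \<open>ss\<close>
    and \<open>es\<close>.\<close>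
  show "strategy_scheme G win_scheme \<and>
      card (Mem win_scheme) = W * (max 1 (max_reward G k \<rho> * W)) ^ (k * (W div D)) \<and>
      permissive G win_scheme (window_stability G k W D \<rho> \<mu> \<nu>) \<and>
      (\<forall>ss es. presents G ss es \<longrightarrow>
        (\<exists>t s. exec window_prog (input_store G ss es k W D \<rho> \<mu> \<nu>) t s \<and>
           output_scheme G ss es win_scheme s \<and>
           t \<le> 2000 * ((card (states G))\<^sup>2 * card (edges G) * W\<^sup>2 *
                     (max 2 (max_reward G k \<rho> * W)) ^ (2 * k * (W div D)))))"
  proof (intro conjI allI impI)
    show "strategy_scheme G win_scheme" by (rule strategy_scheme_win)
    show "card (Mem win_scheme) = W * (max 1 (max_reward G k \<rho> * W)) ^ (k * (W div D))"
      by (simp only: win_scheme_simps card_lessThan) (simp only: N_def B_def K_def)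
    show "permissive G win_scheme (window_stability G k W D \<rho> \<mu> \<nu>)" by (rule permissive_win_scheme)
    fix ss es assume "presents G ss es"
    then interpret presented_game G k W D \<rho> \<mu> \<nu> ss es by unfold_locales
    show "\<exists>t s. exec window_prog (input_store G ss es k W D \<rho> \<mu> \<nu>) t s \<and>
           output_scheme G ss es win_scheme s \<and>
           t \<le> 2000 * ((card (states G))\<^sup>2 * card (edges G) * W\<^sup>2 *
                     (max 2 (max_reward G k \<rho> * W)) ^ (2 * k * (W div D)))"
      using window_prog time_bound_le unfolding runs_def using le_trans by blast
  qed
qed

end
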